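(* For each of the following power series $F(t)=\sum_{k\ge0}g_kt^k$ with associated integer $N$, each listed value $t_0$ with listed sign $\epsilon_p$, and each prime $p$ not dividing $N$, we have $F_p(t_0)\equiv\epsilon_p\pmod{p^2}$, where $F_p(t)=\sum_{k=0}^{p-1}g_kt^k$ and $\chi_{-m}(p)=\left(\frac{-m}{p}\right)$ is the Kronecker symbol: (a) $g_k=\binom{2k}{k}^2$, $N=4$: $t_0=1/16$, $\epsilon_p=\chi_{-4}(p)$. (b) $g_k=\frac{(3k)!}{k!^3}$, $N=3$: $t_0=1/27$, $\epsilon_p=\chi_{-3}(p)$. (c) $g_k=\sum_{j=0}^k\binom{k}{j}^3$, $N=6$: $t_0=1/8$ with $\epsilon_p=\chi_{-3}(p)$, and $t_0=-1$ with $\epsilon_p=\chi_{-3}(p)$. (d) $g_k=\sum_{j=0}^k\binom{k}{j}^2\binom{2j}{j}$, $N=6$: $t_0=1/9$ with $\epsilon_p=\chi_{-3}(p)$, and $t_0=1$ with $\epsilon_p=1$. (e) $g_k=\sum_{j=0}^{k}(-1)^j8^{k-j}\binom{k}{j}\sum_{i=0}^j\binom{j}{i}^3$, $N=6$: $t_0=1/9$ with $\epsilon_p=\chi_{-3}(p)$, and $t_0=1/8$ with $\epsilon_p=1$. (f) $g_k=\sum_{j=0}^{\lfloor k/2\rfloor}4^{k-2j}\binom{k}{2j}\binom{2j}{j}^2$, $N=8$: $t_0=1/8$ with $\epsilon_p=\chi_{-4}(p)$, and $t_0=1/4$ with $\epsilon_p=1$.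
   Context: These are the power series solutions of, respectively, the hypergeometric cases ${}_2F_1(1/2,1/2;1|16t)$, ${}_2F_1(1/3,2/3;1|27t)$, and Zagier's Apéry-like cases A, C, F, E. *)

theory Defs
  imports "HOL-Number_Theory.Number_Theory"
begin

text \<open>The truncation \<open>F\<^sub>p\<close> of \<open>F(t) = \<Sum>k. g k * t ^ k\<close>, evaluated at \<open>t\<close>.\<close>

definition truncated_series :: "(nat \<Rightarrow> rat) \<Rightarrow> nat \<Rightarrow> rat \<Rightarrow> rat" where
  "truncated_series g p t = (\<Sum>k = 0..p - 1. g k * t ^ k)"

definition seq_a :: "nat \<Rightarrow> rat" where
  "seq_a k = of_nat ((2 * k) choose k) ^ 2"

definition seq_b :: "nat \<Rightarrow> rat" where
  "seq_b k = fact (3 * k) / fact k ^ 3"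

definition seq_c :: "nat \<Rightarrow> rat" where
  "seq_c k = (\<Sum>j = 0..k. of_nat (k choose j) ^ 3)"

definition seq_d :: "nat \<Rightarrow> rat" where
  "seq_d k = (\<Sum>j = 0..k. of_nat (k choose j) ^ 2 * of_nat ((2 * j) choose j))"

definition seq_e :: "nat \<Rightarrow> rat" where
  "seq_e k = (\<Sum>j = 0..k. (-1) ^ j * 8 ^ (k - j) * of_nat (k choose j)
                * (\<Sum>i = 0..j. of_nat (j choose i) ^ 3))"

definition seq_f :: "nat \<Rightarrow> rat" where
  "seq_f k = (\<Sum>j = 0..k div 2. 4 ^ (k - 2 * j) * of_nat (k choose (2 * j))
                * of_nat ((2 * j) choose j) ^ 2)"

text \<open>The localization of the integers at the prime \<open>p\<close>, as a subring of the rationals.\<close>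

definition localized_ints :: "nat \<Rightarrow> rat set" where
  "localized_ints p = {of_int u / of_int v | u v :: int. \<not> int p dvd v}"

text \<open>
  Congruence modulo \<open>p ^ n\<close> in the localization at \<open>p\<close>. The library's \<open>cong\<close> at type \<open>rat\<close>
  would be congruence in a field and hence carry no information.
\<close>

definition cong_prime_power :: "nat \<Rightarrow> nat \<Rightarrow> rat \<Rightarrow> rat \<Rightarrow> bool" where
  "cong_prime_power p n x y \<longleftrightarrow>
     x \<in> localized_ints p \<and> y \<in> localized_ints p \<and>
     (\<exists>z \<in> localized_ints p. x - y = of_nat p ^ n * z)"

text \<open>
  The Kronecker symbol \<open>(a/p)\<close> with prime lower entry \<open>p\<close>. The library's \<open>Legendre a 2\<close> is \<open>1\<close>
  for every odd \<open>a\<close>, so the value at \<open>p = 2\<close> has to be given separately.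
\<close>

definition kronecker_prime :: "int \<Rightarrow> nat \<Rightarrow> int" where
  "kronecker_prime a p =
     (if p = 2 then (if even a then 0 else if a mod 8 = 1 \<or> a mod 8 = 7 then 1 else -1)
      else Legendre a (int p))"

definition chi_minus :: "nat \<Rightarrow> nat \<Rightarrow> rat" where
  "chi_minus m p = of_int (kronecker_prime (- int m) p)"

end

theory Submission
  imports Defs "HOL-Computational_Algebra.Polynomial" "HOL-Computational_Algebra.Formal_Power_Series"
begin

text \<open>
  Cases a and b are instances of the congruence
  \<open>\<Sum>k<p. C(x,k) C(-1-x,k) \<equiv> (-1)^r\<close> modulo \<open>p\<^sup>2\<close>, where \<open>x \<equiv> r\<close> modulo \<open>p\<close> and \<open>0 \<le> r < p\<close>:
  the left-hand sides \<open>S(x)\<close> satisfy \<open>S(x) + S(x-1) = 2 C(x-1,p-1) C(-x-1,p-1)\<close>, and both factors on the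
  right are divisible by \<open>p\<close> unless \<open>p\<close> divides \<open>x\<close>. Case f reduces to the same sums with
  \<open>x = -1/2\<close>: at \<open>1/4\<close> by a partial fraction identity, at \<open>1/8\<close> by the symmetry \<open>j \<leftrightarrow> (p-1)/2 - j\<close>.

  The sequences in c, d and e satisfy \<open>(n+1)\<^sup>2 u(n+1) = (A n(n+1) + L) u(n) - B n\<^sup>2 u(n-1)\<close>, so
  the truncation \<open>F\<^sub>p\<close> solves \<open>(w F')' + (B t - L) F = 0\<close> with \<open>w = t (1 - A t + B t\<^sup>2)\<close> modulo \<open>p\<^sup>2\<close>.
  Solutions of degree less than \<open>p\<close> are determined modulo \<open>p\<^sup>2\<close> by their value at any zero of \<open>w\<close>. Moving
  the zeros \<open>-1\<close> and \<open>1/8\<close> of case c to the origin turns its equation into those of e and d, whence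
  \<open>c(t) \<equiv> c(-1) e((t+1)/9)\<close> and \<open>c(t) \<equiv> c(1/8) d((1-8t)/9)\<close>. All values then follow from
  \<open>c(-1)\<close>, which reduces to \<open>\<Sum>k<p. C(2k,k)\<close>, and from \<open>d(1)\<close>, which reduces to \<open>\<Sum>j<p. p/(2j+1)\<close>.
\<close>

section \<open>Congruences in the localization at a prime\<close>

lemma gbinomial_altdef_prod: "(a :: rat) gchoose k = (\<Prod>i<k. a - of_nat i) / fact k"
  by (simp add: gbinomial_prod_rev atLeast0LessThan)

lemma gbinomial_minus_one: "(- 1 :: rat) gchoose k = (- 1) ^ k"
  using gbinomial_minus[of "1 :: rat" k] by (simp add: binomial_gbinomial[symmetric])

text \<open>The ideal generated by p^n in the localization, as a set, so that congruence proofs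
  become closure arguments about membership.\<close>

definition prime_power_ideal :: "nat \<Rightarrow> nat \<Rightarrow> rat set" where
  "prime_power_ideal p n = {of_nat p ^ n * z | z. z \<in> localized_ints p}"

locale prime_localization =
  fixes p :: nat
  assumes prime_p: "prime p"
begin

abbreviation Zp :: "rat set" where "Zp \<equiv> localized_ints p"
abbreviation Ip :: "nat \<Rightarrow> rat set" where "Ip \<equiv> prime_power_ideal p"

text \<open>Unlike \<open>cong_prime_power\<close>, this demands nothing of the two sides
  separately, so congruences can be chained freely; \<open>cong_prime_powerI\<close> recovers
  integrality at the end from that of the right side.\<close>

definition pcong :: "nat \<Rightarrow> rat \<Rightarrow> rat \<Rightarrow> bool" where
  "pcong n x y \<longleftrightarrow> x - y \<in> Ip n"

lemma p_pos: "0 < p" using prime_p prime_gt_0_nat by blast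

lemma ZpI: "\<not> int p dvd v \<Longrightarrow> x = of_int u / of_int v \<Longrightarrow> x \<in> Zp"
  unfolding localized_ints_def by blast

lemma ZpE:
  assumes "x \<in> Zp"
  obtains u v where "\<not> int p dvd v" "v \<noteq> 0" "x = of_int u / of_int v"
  using assms unfolding localized_ints_def by (auto intro: that)

lemma not_dvd_mult: "\<not> int p dvd a \<Longrightarrow> \<not> int p dvd b \<Longrightarrow> \<not> int p dvd a * b"
  using prime_p by (simp add: prime_dvd_mult_iff)

lemma Zp_of_int [simp, intro]: "of_int u \<in> Zp"
  by (rule ZpI[of 1 _ u]) (use prime_p in \<open>auto simp: zdvd1_eq\<close>)

lemma Zp_of_nat [simp, intro]: "of_nat u \<in> Zp"
  using Zp_of_int[of "int u"] by simp

lemma Zp_numeral [simp, intro]: "numeral u \<in> Zp"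
  using Zp_of_int[of "numeral u"] by simp

lemma Zp_0 [simp, intro]: "0 \<in> Zp" and Zp_1 [simp, intro]: "1 \<in> Zp"
  using Zp_of_int[of 0] Zp_of_int[of 1] by auto

lemma Zp_add [intro]:
  assumes "x \<in> Zp" "y \<in> Zp" shows "x + y \<in> Zp"
proof -
  from assms(1) obtain u v where 1: "\<not> int p dvd v" "v \<noteq> 0" "x = of_int u / of_int v" by (rule ZpE)
  from assms(2) obtain u' v' where 2: "\<not> int p dvd v'" "v' \<noteq> 0" "y = of_int u' / of_int v'" by (rule ZpE)
  show ?thesis
    by (rule ZpI[OF not_dvd_mult[OF 1(1) 2(1)], of _ "u * v' + u' * v"])
      (use 1 2 in \<open>simp add: field_simps\<close>)
qed

lemma Zp_mult [intro]:
  assumes "x \<in> Zp" "y \<in> Zp" shows "x * y \<in> Zp"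
proof -
  from assms(1) obtain u v where 1: "\<not> int p dvd v" "v \<noteq> 0" "x = of_int u / of_int v" by (rule ZpE)
  from assms(2) obtain u' v' where 2: "\<not> int p dvd v'" "v' \<noteq> 0" "y = of_int u' / of_int v'" by (rule ZpE)
  show ?thesis
    by (rule ZpI[OF not_dvd_mult[OF 1(1) 2(1)], of _ "u * u'"])
      (simp add: 1(3) 2(3))
qed

lemma Zp_uminus [intro]: "x \<in> Zp \<Longrightarrow> - x \<in> Zp"
  using Zp_mult[OF Zp_of_int[of "- 1"], of x] by simp

lemma Zp_diff [intro]: "x \<in> Zp \<Longrightarrow> y \<in> Zp \<Longrightarrow> x - y \<in> Zp"
  using Zp_add[of x "- y"] Zp_uminus by simp

lemma Zp_power [intro]: "x \<in> Zp \<Longrightarrow> x ^ n \<in> Zp"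
  by (induction n) auto

lemma Zp_sum [intro]: "(\<And>i. i \<in> A \<Longrightarrow> f i \<in> Zp) \<Longrightarrow> sum f A \<in> Zp"
  by (induction A rule: infinite_finite_induct) auto

lemma Zp_prod [intro]: "(\<And>i. i \<in> A \<Longrightarrow> f i \<in> Zp) \<Longrightarrow> prod f A \<in> Zp"
  by (induction A rule: infinite_finite_induct) auto

lemma Zp_divide_int:
  assumes "x \<in> Zp" "\<not> int p dvd m"
  shows "x / of_int m \<in> Zp"
proof -
  have "of_int 1 / of_int m \<in> Zp" using assms(2) by (intro ZpI[OF assms(2) refl])
  with Zp_mult[OF assms(1) this] show ?thesis by simp
qed

lemma Zp_divide_nat:
  assumes "x \<in> Zp" "\<not> p dvd m"
  shows "x / of_nat m \<in> Zp"
  using Zp_divide_int[OF assms(1), of "int m"] assms(2) by simp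

lemma Zp_divide_less:
  assumes "x \<in> Zp" "0 < m" "m < p"
  shows "x / of_nat m \<in> Zp"
  using Zp_divide_nat[OF assms(1)] assms by (simp add: nat_dvd_not_less)

lemma Zp_divide_fact:
  assumes "x \<in> Zp" "k < p"
  shows "x / fact k \<in> Zp"
  using Zp_divide_nat[OF assms(1), of "fact k"] assms prime_p by (simp add: prime_dvd_fact_iff)

lemma IpI: "z \<in> Zp \<Longrightarrow> x = of_nat p ^ n * z \<Longrightarrow> x \<in> Ip n"
  unfolding prime_power_ideal_def by blast

lemma IpE:
  assumes "x \<in> Ip n"
  obtains z where "z \<in> Zp" "x = of_nat p ^ n * z"
  using assms unfolding prime_power_ideal_def by blast

lemma Ip_0 [simp, intro]: "0 \<in> Ip n"
  by (rule IpI[of 0]) auto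

lemma Ip_zero_eq [simp]: "Ip 0 = Zp"
  unfolding prime_power_ideal_def by simp

lemma Ip_subset_Zp: "x \<in> Ip n \<Longrightarrow> x \<in> Zp"
  by (erule IpE) auto

lemma Ip_add [intro]: "x \<in> Ip n \<Longrightarrow> y \<in> Ip n \<Longrightarrow> x + y \<in> Ip n"
  by (elim IpE) (metis IpI Zp_add distrib_left)

lemma Ip_mult: "x \<in> Ip m \<Longrightarrow> y \<in> Ip n \<Longrightarrow> x * y \<in> Ip (m + n)"
proof (elim IpE)
  fix z w assume "z \<in> Zp" "x = of_nat p ^ m * z" "w \<in> Zp" "y = of_nat p ^ n * w"
  then show ?thesis by (intro IpI[of "z * w"]) (auto simp: power_add)
qed

lemma Ip_1_mult: "x \<in> Ip 1 \<Longrightarrow> y \<in> Ip 1 \<Longrightarrow> x * y \<in> Ip 2"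
  using Ip_mult[of x 1 y 1] by (simp only: one_add_one)

lemma Ip_mult_Zp: "x \<in> Ip n \<Longrightarrow> y \<in> Zp \<Longrightarrow> x * y \<in> Ip n"
  using Ip_mult[of x n y 0] by simp

lemma Zp_mult_Ip: "x \<in> Zp \<Longrightarrow> y \<in> Ip n \<Longrightarrow> x * y \<in> Ip n"
  using Ip_mult_Zp[of y n x] by (simp add: mult.commute)

lemma Ip_uminus [intro]: "x \<in> Ip n \<Longrightarrow> - x \<in> Ip n"
  using Ip_mult_Zp[OF _ Zp_of_int[of "- 1"], of x n] by simp

lemma Ip_diff [intro]: "x \<in> Ip n \<Longrightarrow> y \<in> Ip n \<Longrightarrow> x - y \<in> Ip n"
  using Ip_add[of x n "- y"] Ip_uminus by simp

lemma Ip_sum [intro]: "(\<And>i. i \<in> A \<Longrightarrow> f i \<in> Ip n) \<Longrightarrow> sum f A \<in> Ip n"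
  by (induction A rule: infinite_finite_induct) auto

lemma Ip_divide_nat:
  assumes "x \<in> Ip n" "\<not> p dvd m"
  shows "x / of_nat m \<in> Ip n"
  using Zp_divide_nat[OF Zp_1 assms(2)] Ip_mult_Zp[OF assms(1)] by fastforce

lemma Ip_cancel_nat:
  assumes "of_nat m * x \<in> Ip n" "\<not> p dvd m"
  shows "x \<in> Ip n"
proof -
  have "m \<noteq> 0" using assms(2) by (intro notI) simp
  then show ?thesis using Ip_divide_nat[OF assms] by simp
qed

lemma of_nat_Ip: "p ^ n dvd m \<Longrightarrow> of_nat m \<in> Ip n"
  by (elim dvdE) (auto intro!: IpI[OF Zp_of_nat] of_nat_mult simp: of_nat_power[symmetric] simp del: of_nat_power)

lemma of_nat_Ip_1: "p dvd m \<Longrightarrow> of_nat m \<in> Ip 1"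
  using of_nat_Ip[of 1] by simp

lemma p_in_Ip_1: "of_nat p \<in> Ip 1"
  by (rule of_nat_Ip_1) simp

lemma p_mult_Ip_1: "x \<in> Ip 1 \<Longrightarrow> of_nat p * x \<in> Ip 2"
  by (rule Ip_1_mult[OF p_in_Ip_1])

lemma pcong_refl [simp, intro]: "pcong n x x"
  by (simp add: pcong_def)

lemma pcong_sym: "pcong n x y \<Longrightarrow> pcong n y x"
  unfolding pcong_def using Ip_uminus by fastforce

lemma pcong_trans [trans]: "pcong n x y \<Longrightarrow> pcong n y z \<Longrightarrow> pcong n x z"
  unfolding pcong_def using Ip_add by fastforce

lemma pcong_eq_trans [trans]: "pcong n x y \<Longrightarrow> y = z \<Longrightarrow> pcong n x z"
  and eq_pcong_trans [trans]: "x = y \<Longrightarrow> pcong n y z \<Longrightarrow> pcong n x z"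
  by auto

lemma pcong_add: "pcong n x y \<Longrightarrow> pcong n x' y' \<Longrightarrow> pcong n (x + x') (y + y')"
  unfolding pcong_def using Ip_add[of "x - y" n "x' - y'"] by (simp add: algebra_simps)

lemma pcong_sum: "(\<And>i. i \<in> A \<Longrightarrow> pcong n (f i) (g i)) \<Longrightarrow> pcong n (sum f A) (sum g A)"
  unfolding pcong_def sum_subtractf[symmetric] by (rule Ip_sum)

lemma pcong_mult_left: "z \<in> Zp \<Longrightarrow> pcong n x y \<Longrightarrow> pcong n (z * x) (z * y)"
  unfolding pcong_def using Zp_mult_Ip[of z "x - y" n] by (simp add: algebra_simps)

lemma pcong_mult:
  assumes "pcong n x y" "pcong n x' y'" "x \<in> Zp" "y' \<in> Zp"
  shows "pcong n (x * x') (y * y')"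
proof -
  have "x * x' - y * y' = x * (x' - y') + (x - y) * y'" by (simp add: algebra_simps)
  then show ?thesis
    using assms Zp_mult_Ip Ip_mult_Zp unfolding pcong_def by (metis Ip_add)
qed

lemma pcong_Zp: "pcong n x y \<Longrightarrow> y \<in> Zp \<Longrightarrow> x \<in> Zp"
  unfolding pcong_def using Zp_add[of "x - y" y] Ip_subset_Zp by simp

lemma pcong_prod:
  assumes "\<And>i. i \<in> A \<Longrightarrow> pcong n (f i) (g i)" "\<And>i. i \<in> A \<Longrightarrow> g i \<in> Zp"
  shows "pcong n (prod f A) (prod g A)"
  using assms
proof (induction A rule: infinite_finite_induct)
  case (insert a A)
  have "pcong n (f a * prod f A) (g a * prod g A)"
    using insert by (intro pcong_mult) (auto intro: pcong_Zp)
  with insert show ?case by simp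
qed auto

lemma pcong_divide_fact:
  assumes "pcong n x y" "k < p"
  shows "pcong n (x / fact k) (y / fact k)"
  using pcong_mult_left[OF Zp_divide_fact[OF Zp_1 assms(2)] assms(1)] by simp

lemma cong_prime_powerI:
  assumes "pcong n x y" "y \<in> Zp"
  shows "cong_prime_power p n x y"
  using assms pcong_Zp[OF assms] unfolding cong_prime_power_def pcong_def prime_power_ideal_def
  by auto

lemma gbinomial_Zp: "a \<in> Zp \<Longrightarrow> k < p \<Longrightarrow> a gchoose k \<in> Zp"
  unfolding gbinomial_altdef_prod by (intro Zp_divide_fact Zp_prod Zp_diff) auto

text \<open>The falling factorials agree factor by factor, and \<open>fact k\<close> is a unit for k
  < p.\<close>

lemma gbinomial_pcong:
  assumes "pcong n a b" "b \<in> Zp" "k < p"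
  shows "pcong n (a gchoose k) (b gchoose k)"
proof -
  have "pcong n (a - of_nat i) (b - of_nat i)" for i
    using assms(1) by (simp add: pcong_def)
  then show ?thesis
    unfolding gbinomial_altdef_prod using assms
    by (intro pcong_divide_fact pcong_prod) auto
qed

text \<open>Pairing k with p - k turns twice the sum into a sum of p / (k (p - k)) with unit
  denominators; 2 is a unit since p is odd.\<close>

lemma sum_inverse_Ip:
  assumes "odd p"
  shows "(\<Sum>k = 1..<p. 1 / of_nat k :: rat) \<in> Ip 1"
proof -
  let ?S = "\<Sum>k = 1..<p. 1 / of_nat k :: rat"
  have "?S = (\<Sum>k = 1..<p. 1 / of_nat (p - k))"
    by (rule sum.reindex_bij_witness[of _ "\<lambda>k. p - k" "\<lambda>k. p - k"]) auto
  then have "of_nat 2 * ?S = (\<Sum>k = 1..<p. 1 / of_nat k + 1 / of_nat (p - k))"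
    by (simp add: sum.distrib)
  also have "\<dots> = (\<Sum>k = 1..<p. of_nat p * (1 / of_nat k / of_nat (p - k)))"
    by (intro sum.cong refl) (auto simp: field_simps of_nat_diff)
  also have "\<dots> \<in> Ip 1"
    by (intro Ip_sum Ip_mult_Zp p_in_Ip_1 Zp_divide_less) auto
  finally have "of_nat 2 * ?S \<in> Ip 1" .
  moreover have "\<not> p dvd 2"
    using assms primes_dvd_imp_eq[OF prime_p two_is_prime_nat] by auto
  ultimately show ?thesis by (rule Ip_cancel_nat)
qed

text \<open>For j < p the prime divides 2j+1 only at j = (p-1)/2, where the term equals 1. The other
  terms are paired by j -> p-1-j, under which the denominators add up to 2p; this yields one factor
  p beyond the one in the numerator.\<close>

lemma sum_inverse_odd_pcong:
  assumes "odd p"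
  shows "pcong 2 (\<Sum>j<p. of_nat p / of_nat (2 * j + 1)) 1"
proof -
  define h where "h = (p - 1) div 2"
  have h: "2 * h + 1 = p" "h < p" using assms by (auto simp: h_def elim!: oddE)
  let ?J = "{..<p} - {h}"
  let ?S = "\<Sum>j\<in>?J. 1 / of_nat (2 * j + 1) :: rat"
  have nd: "\<not> p dvd 2 * j + 1" if "j \<in> ?J" for j
  proof
    assume "p dvd 2 * j + 1"
    then obtain c where c: "2 * j + 1 = p * c" by (auto elim: dvdE)
    have "2 * j + 1 < p * 2" using that by auto
    then have "p * c < p * 2" by (simp only: c)
    then have "c < 2" by (simp only: mult_less_cancel1)
    then have "c = 0 \<or> c = 1" by auto
    then show False using c that h by auto
  qed
  have "?S = (\<Sum>j\<in>?J. 1 / of_nat (2 * (p - 1 - j) + 1))"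
    by (rule sum.reindex_bij_witness[of _ "\<lambda>j. p - 1 - j" "\<lambda>j. p - 1 - j"]) (use h in auto)
  then have "of_nat 2 * ?S = (\<Sum>j\<in>?J. 1 / of_nat (2 * j + 1) + 1 / of_nat (2 * (p - 1 - j) + 1))"
    by (simp add: sum.distrib)
  also have "\<dots> = (\<Sum>j\<in>?J. of_nat p * (2 / of_nat (2 * j + 1) / of_nat (2 * (p - 1 - j) + 1)))"
  proof (intro sum.cong refl)
    fix j assume "j \<in> ?J"
    then have *: "(of_nat (2 * (p - 1 - j) + 1) :: rat) = 2 * of_nat p - of_nat (2 * j + 1)"
      by (simp add: of_nat_diff)
    have nz: "(of_nat (2 * j + 1) :: rat) \<noteq> 0" "(of_nat (2 * (p - 1 - j) + 1) :: rat) \<noteq> 0"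
      by (simp_all only: of_nat_eq_0_iff)
    have "1 / x + 1 / y = of_nat p * (2 / x / y)"
      if "x \<noteq> 0" "y \<noteq> 0" "y = 2 * of_nat p - x" for x y :: rat
      using that(1,2) by (simp add: divide_simps) (simp add: that(3))
    from this[OF nz *]
    show "1 / (of_nat (2 * j + 1) :: rat) + 1 / of_nat (2 * (p - 1 - j) + 1) =
        of_nat p * (2 / of_nat (2 * j + 1) / of_nat (2 * (p - 1 - j) + 1))" .
  qed
  also have "\<dots> \<in> Ip 1"
  proof (intro Ip_sum Ip_mult_Zp p_in_Ip_1 Zp_divide_nat)
    fix j assume "j \<in> ?J"
    moreover from this have "p - 1 - j \<in> ?J" using h by auto
    ultimately show "\<not> p dvd 2 * j + 1" "\<not> p dvd 2 * (p - 1 - j) + 1"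
      by (simp_all only: nd not_False_eq_True)
  qed auto
  finally have "of_nat 2 * ?S \<in> Ip 1" .
  moreover have "\<not> p dvd 2"
    using assms primes_dvd_imp_eq[OF prime_p two_is_prime_nat] by auto
  ultimately have "?S \<in> Ip 1" by (rule Ip_cancel_nat)
  then have "of_nat p * ?S \<in> Ip 2" by (rule p_mult_Ip_1)
  moreover have "(\<Sum>j<p. of_nat p / of_nat (2 * j + 1) :: rat) = 1 + of_nat p * ?S"
    using h by (subst sum.remove[of _ h]) (auto simp: sum_distrib_left simp del: of_nat_Suc of_nat_add of_nat_mult)
  ultimately show ?thesis by (simp add: pcong_def)
qed

end

section \<open>Alternating sums of binomial products\<close>

text \<open>Induction on n. By Pascal's rule the left side grows by X'Y + XY' + 2XY, and absorption
  gives X'Y + XY' = -2X'Y', so the increment is exactly that of the right side.\<close>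

lemma gbinomial_product_sum_recurrence:
  fixes a :: rat
  shows "(\<Sum>k\<le>n. (a gchoose k) * ((- 1 - a) gchoose k)) + (\<Sum>k\<le>n. ((a - 1) gchoose k) * ((- a) gchoose k))
    = 2 * ((a - 1) gchoose n) * ((- a - 1) gchoose n)"
proof (induction n)
  case (Suc n)
  define X' X Y' Y where defs: "X' = (a - 1) gchoose n" "X = (a - 1) gchoose Suc n"
    "Y' = (- a - 1) gchoose n" "Y = (- a - 1) gchoose Suc n"
  have 1: "a gchoose Suc n = X' + X" "(- a) gchoose Suc n = Y' + Y"
    using gbinomial_Suc_Suc[of "a - 1" n] gbinomial_Suc_Suc[of "- a - 1" n] by (simp_all add: defs)
  have 2: "of_nat (Suc n) * X = (a - of_nat (Suc n)) * X'"
    "of_nat (Suc n) * Y = (- a - of_nat (Suc n)) * Y'"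
    unfolding defs using gbinomial_absorption[of n "a - 1"] gbinomial_absorb_comp[of "a - 1" n]
      gbinomial_absorption[of n "- a - 1"] gbinomial_absorb_comp[of "- a - 1" n]
    by (simp_all add: algebra_simps)
  have "of_nat (Suc n) * (X' * Y + X * Y') = of_nat (Suc n) * (- 2 * X' * Y')"
    using 2 by (auto simp del: of_nat_Suc) Groebner_Basis.algebra
  then have 3: "X' * Y + X * Y' = - 2 * X' * Y'" by (simp only: mult_cancel_left of_nat_eq_0_iff) simp
  have 4: "- 1 - a = - a - 1" by simp
  show ?case
    unfolding sum.atMost_Suc 1 4 using Suc 3 unfolding 4 defs[symmetric]
    by Groebner_Basis.algebra
qed simp

text \<open>Vandermonde's convolution for C(-1,n) with -1 split as (-n-1) + n; upper negation turns
  C(-n-1,i) into (-1)^i C(n+i,i).\<close>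

lemma alternating_sum_binomial_product:
  "(\<Sum>i\<le>n. (- 1) ^ i * of_nat (n choose i) * of_nat ((n + i) choose i) :: rat) = (- 1) ^ n"
proof -
  have "(- 1) ^ n = (- 1 gchoose n :: rat)" by (simp only: gbinomial_minus_one)
  also have "\<dots> = ((- of_nat n - 1 + of_nat n) gchoose n)" by simp
  also have "\<dots> = (\<Sum>i\<le>n. ((- of_nat n - 1) gchoose i) * (of_nat n gchoose (n - i)))"
    by (simp only: gbinomial_Vandermonde[symmetric] atLeast0AtMost)
  also have "\<dots> = (\<Sum>i\<le>n. (- 1) ^ i * of_nat (n choose i) * of_nat ((n + i) choose i))"
  proof (intro sum.cong refl)
    fix i assume "i \<in> {..n}"
    moreover have "(- of_nat n - 1 :: rat) gchoose i = (- 1) ^ i * of_nat ((n + i) choose i)"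
      using gbinomial_minus[of "of_nat n + 1 :: rat" i] by (simp add: binomial_gbinomial)
    ultimately show "((- of_nat n - 1 :: rat) gchoose i) * (of_nat n gchoose (n - i))
        = (- 1) ^ i * of_nat (n choose i) * of_nat ((n + i) choose i)"
      by (simp add: gbinomial_of_nat_symmetric[symmetric] binomial_gbinomial)
  qed
  finally show ?thesis by simp
qed

text \<open>Writing (x+n+1)/(x+i) = 1 + (n+1-i)/(x+i) separates off the alternating sum (-1)^(n+1).
  In the rest \<open>cc\<close> trades the coefficients of row n+1 for those of row n, and the sign
  is reabsorbed as minus the alternating sum of row n.\<close>

lemma partial_fraction_sum_recurrence:
  fixes x :: rat
  assumes "\<And>i. x + of_nat i \<noteq> 0"
  defines "R \<equiv> \<lambda>n. \<Sum>i\<le>n. (- 1) ^ i * of_nat (n choose i) * of_nat ((n + i) choose i) / (x + of_nat i)"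
  shows "(x + of_nat (Suc n)) * R (Suc n) = (of_nat (Suc n) - x) * R n"
proof -
  define c where "c = (\<lambda>n i. (- 1) ^ i * of_nat (n choose i) * of_nat ((n + i) choose i) :: rat)"
  have R: "R m = (\<Sum>i\<le>m. c m i / (x + of_nat i))" for m by (simp add: R_def c_def)
  have c0: "c n (Suc n) = 0" by (simp add: c_def)
  have cc: "(of_nat (Suc n) - of_nat i) * c (Suc n) i = (of_nat (Suc n) + of_nat i) * c n i"
    if "i \<le> Suc n" for i
  proof -
    have "(Suc n - i) * (Suc n choose i) = Suc n * (n choose i)"
      using binomial_absorb_comp[of "Suc n" i] by simp
    then have 1: "(of_nat (Suc n) - of_nat i) * of_nat (Suc n choose i) = (of_nat (Suc n) * of_nat (n choose i) :: rat)"
      using that by (metis of_nat_diff of_nat_mult)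
    have "Suc n * ((Suc n + i) choose i) = (Suc n + i) * ((n + i) choose i)"
      using binomial_absorb_comp[of "Suc n + i" i] by simp
    then have 2: "of_nat (Suc n) * of_nat ((Suc n + i) choose i) = ((of_nat (Suc n) + of_nat i) * of_nat ((n + i) choose i) :: rat)"
      by (metis of_nat_add of_nat_mult)
    have "(u - v) * (s * x * y) = (u + v) * (s * x' * y')"
      if "(u - v) * x = u * x'" "u * y = (u + v) * y'" for u v s x y x' y' :: rat
      using that by Groebner_Basis.algebra
    from this[OF 1 2] show ?thesis unfolding c_def .
  qed
  have "(x + of_nat (Suc n)) * R (Suc n) = (\<Sum>i\<le>Suc n. c (Suc n) i + (of_nat (Suc n) - of_nat i) * c (Suc n) i / (x + of_nat i))"
    unfolding R sum_distrib_left
  proof (intro sum.cong refl)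
    fix i
    have "x + of_nat i \<noteq> 0" by (rule assms)
    then show "(x + of_nat (Suc n)) * (c (Suc n) i / (x + of_nat i)) = c (Suc n) i + (of_nat (Suc n) - of_nat i) * c (Suc n) i / (x + of_nat i)"
      by (simp add: divide_simps) (simp add: algebra_simps)
  qed
  also have "\<dots> = (- 1) ^ Suc n + (\<Sum>i\<le>Suc n. (of_nat (Suc n) - of_nat i) * c (Suc n) i / (x + of_nat i))"
    using alternating_sum_binomial_product[of "Suc n"] unfolding sum.distrib c_def by simp
  also have "(\<Sum>i\<le>Suc n. (of_nat (Suc n) - of_nat i) * c (Suc n) i / (x + of_nat i))
      = (\<Sum>i\<le>Suc n. (of_nat (Suc n) + of_nat i) * c n i / (x + of_nat i))"
    by (intro sum.cong refl) (simp only: cc atMost_iff)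
  also have "\<dots> = (\<Sum>i\<le>n. (of_nat (Suc n) + of_nat i) * c n i / (x + of_nat i))"
    using c0 by simp
  also have "(- 1) ^ Suc n + \<dots> = (\<Sum>i\<le>n. - c n i + (of_nat (Suc n) + of_nat i) * c n i / (x + of_nat i))"
    using alternating_sum_binomial_product[of n] unfolding sum.distrib sum_negf c_def by simp
  also have "\<dots> = (of_nat (Suc n) - x) * R n"
    unfolding R sum_distrib_left
  proof (intro sum.cong refl)
    fix i
    have "x + of_nat i \<noteq> 0" by (rule assms)
    then show "- c n i + (of_nat (Suc n) + of_nat i) * c n i / (x + of_nat i) = (of_nat (Suc n) - x) * (c n i / (x + of_nat i))"
      by (simp add: divide_simps) (simp add: algebra_simps)
  qed
  finally show ?thesis .
qed

text \<open>The partial fraction decomposition of the right side, obtained from the first-order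
  recurrence in n that both sides satisfy.\<close>

lemma partial_fraction_sum:
  fixes x :: rat
  assumes "\<And>i. x + of_nat i \<noteq> 0"
  shows "(\<Sum>i\<le>n. (- 1) ^ i * of_nat (n choose i) * of_nat ((n + i) choose i) / (x + of_nat i))
    = pochhammer (1 - x) n / pochhammer x (Suc n)"
proof (induction n)
  case 0
  show ?case by simp
next
  case (Suc n)
  define R where "R \<equiv> \<lambda>n. \<Sum>i\<le>n. (- 1) ^ i * of_nat (n choose i) * of_nat ((n + i) choose i) / (x + of_nat i)"
  have "(x + of_nat (Suc n)) * R (Suc n) = (of_nat (Suc n) - x) * R n"
    unfolding R_def by (rule partial_fraction_sum_recurrence[OF assms])
  moreover have nz: "x + of_nat (Suc n) \<noteq> 0" by (rule assms)
  ultimately have "R (Suc n) = (1 - x + of_nat n) * R n / (x + of_nat (Suc n))"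
    by (simp add: field_simps)
  also have "R n = pochhammer (1 - x) n / pochhammer x (Suc n)" unfolding R_def by (rule Suc)
  finally show ?case
    unfolding R_def by (simp add: pochhammer_Suc mult_ac)
qed

text \<open>The case x = 1/2, where 1 - x = x and the Pochhammer quotient collapses to 1 / (1/2 +
  n).\<close>

lemma alternating_sum_binomial_product_odd:
  "(\<Sum>i\<le>n. (- 1) ^ i * of_nat (n choose i) * of_nat ((n + i) choose i) / of_nat (2 * i + 1) :: rat)
    = 1 / of_nat (2 * n + 1)"
proof -
  have nz: "(1/2 :: rat) + of_nat i \<noteq> 0" for i
    using of_nat_0_le_iff[where ?'a = rat, of i] by linarith
  have "pochhammer (1/2 :: rat) n \<noteq> 0" for n
    unfolding pochhammer_eq_0_iff using nz by (auto simp: eq_neg_iff_add_eq_0)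
  then have "pochhammer (1 - 1/2 :: rat) n / pochhammer (1/2) (Suc n) = 1 / (1/2 + of_nat n)"
    by (simp add: pochhammer_Suc)
  with partial_fraction_sum[OF nz, of n]
  have "(\<Sum>i\<le>n. (- 1) ^ i * of_nat (n choose i) * of_nat ((n + i) choose i) / (1/2 + of_nat i) :: rat)
      = 1 / (1/2 + of_nat n)" by simp
  moreover have "y / of_nat (2 * i + 1) = (1/2) * (y / (1/2 + of_nat i))" for i and y :: rat
    using nz[of i] by (simp add: divide_simps)
  ultimately show ?thesis
    by (simp only: sum_distrib_left[symmetric])
qed

text \<open>The case x = j + 1, n = j: the numerator is (-1)^j j! and the denominator is (2j+1)! /
  j!. It serves the value d(1).\<close>

lemma alternating_sum_binomial_product_shifted:
  "of_nat ((2 * j) choose j) * (\<Sum>i\<le>j. (- 1) ^ (j + i) * of_nat (j choose i) * of_nat ((j + i) choose i) / of_nat (j + i + 1) :: rat)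
    = 1 / of_nat (2 * j + 1)"
proof -
  have nz: "(of_nat j + 1 :: rat) + of_nat i \<noteq> 0" for i
    using of_nat_0_le_iff[where ?'a = rat, of i] of_nat_0_le_iff[where ?'a = rat, of j] by linarith
  have "pochhammer (1 - (of_nat j + 1)) j = (- 1) ^ j * (fact j :: rat)"
    using pochhammer_same[of j] by simp
  moreover have "pochhammer (of_nat j + 1) (Suc j) = of_nat (2 * j + 1) * (of_nat ((2 * j) choose j) * fact j :: rat)"
  proof -
    have "fact j * pochhammer (of_nat j + 1) (Suc j) = (fact (2 * j + 1) :: rat)"
      using pochhammer_product'[of "1::rat" j "Suc j"]
      by (simp add: pochhammer_fact[symmetric] mult_2 add.commute del: fact_Suc)
    also have "\<dots> = of_nat (2 * j + 1) * fact (2 * j)" by simp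
    also have "(fact (2 * j) :: rat) = of_nat ((2 * j) choose j) * fact j * fact j"
      by (simp add: binomial_fact)
    finally have "fact j * pochhammer (of_nat j + 1) (Suc j) =
        fact j * (of_nat (2 * j + 1) * (of_nat ((2 * j) choose j) * fact j :: rat))"
      by (simp only: mult_ac)
    then show ?thesis by (simp only: mult_cancel_left fact_nonzero if_False) simp
  qed
  moreover have "of_nat ((2 * j) choose j) \<noteq> (0 :: rat)" by simp
  ultimately have "of_nat ((2 * j) choose j) * (- 1) ^ j * (pochhammer (1 - (of_nat j + 1)) j / pochhammer (of_nat j + 1) (Suc j))
      = 1 / (of_nat (2 * j + 1) :: rat)"
    by (simp add: field_simps del: of_nat_Suc of_nat_add of_nat_mult)
  moreover have "(\<Sum>i\<le>j. (- 1) ^ (j + i) * of_nat (j choose i) * of_nat ((j + i) choose i) / of_nat (j + i + 1) :: rat)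
     = (- 1) ^ j * (\<Sum>i\<le>j. (- 1) ^ i * of_nat (j choose i) * of_nat ((j + i) choose i) / (of_nat j + 1 + of_nat i))"
    by (simp add: sum_distrib_left power_add algebra_simps)
  ultimately show ?thesis
    using partial_fraction_sum[OF nz, of j] by (simp only: mult.assoc)
qed

section \<open>The hypergeometric cases\<close>

lemma gbinomial_Suc_mult: "of_nat (Suc k) * (a gchoose Suc k) = (a - of_nat k) * ((a :: rat) gchoose k)"
  by (simp only: gbinomial_absorption gbinomial_absorb_comp)

lemma central_binomial_Suc:
  "of_nat (Suc k) * of_nat ((2 * Suc k) choose Suc k) = (2 * of_nat (2 * k + 1) * of_nat ((2 * k) choose k) :: rat)"
proof -
  have "fact (2 * Suc k) = (2 * of_nat (Suc k) * of_nat (2 * k + 1) * fact (2 * k) :: rat)"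
    by (simp add: algebra_simps)
  moreover have "of_nat ((2 * Suc k) choose Suc k) = fact (2 * Suc k) / (fact (Suc k) * fact (Suc k) :: rat)"
  proof -
    have "Suc k \<le> 2 * Suc k" "2 * Suc k - Suc k = Suc k" by simp_all
    then show ?thesis using binomial_fact[of "Suc k" "2 * Suc k", where ?'a = rat] by (simp only:)
  qed
  moreover have "of_nat ((2 * k) choose k) = fact (2 * k) / (fact k * fact k :: rat)"
    by (simp add: binomial_fact)
  moreover have "fact (Suc k) = (of_nat (Suc k) * fact k :: rat)" by simp
  moreover have "S * ((2 * S * D * F) / (S * f * (S * f))) = 2 * D * (F / (f * f))"
    if "S \<noteq> 0" "f \<noteq> 0" for S D F f :: rat
    using that by (simp add: field_simps)
  from this[of "of_nat (Suc k)" "fact k"]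
  have "of_nat (Suc k) * ((2 * of_nat (Suc k) * of_nat (2 * k + 1) * fact (2 * k)) / (of_nat (Suc k) * fact k * (of_nat (Suc k) * fact k)))
      = (2 * of_nat (2 * k + 1) * (fact (2 * k) / (fact k * fact k)) :: rat)"
    by (simp del: of_nat_Suc)
  ultimately show ?thesis by (simp only:)
qed

lemma gbinomial_minus_half: "(- 1/2 :: rat) gchoose k = (- 1) ^ k * of_nat ((2 * k) choose k) / 4 ^ k"
proof (induction k)
  case (Suc k)
  have "of_nat (Suc k) * ((- 1/2 :: rat) gchoose Suc k) = (- 1/2 - of_nat k) * ((- 1) ^ k * of_nat ((2 * k) choose k) / 4 ^ k)"
    by (simp only: gbinomial_Suc_mult Suc)
  also have "\<dots> = (- 1) ^ Suc k * (2 * of_nat (2 * k + 1) * of_nat ((2 * k) choose k)) / 4 ^ Suc k"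
    by (simp add: field_simps)
  also have "\<dots> = of_nat (Suc k) * ((- 1) ^ Suc k * of_nat ((2 * Suc k) choose Suc k) / 4 ^ Suc k)"
    unfolding central_binomial_Suc[symmetric] by (simp only: mult_ac times_divide_eq_right)
  finally show ?case by (simp only: mult_cancel_left of_nat_eq_0_iff) simp
qed simp

lemma gbinomial_minus_half_square: "((- 1/2 :: rat) gchoose k)\<^sup>2 = (of_nat ((2 * k) choose k))\<^sup>2 / 16 ^ k"
proof -
  have "(4 ^ k)\<^sup>2 = (16 ^ k :: rat)" by (simp add: power2_eq_square flip: power_mult_distrib)
  then show ?thesis
    unfolding gbinomial_minus_half by (simp add: power_divide power_mult_distrib power2_eq_square[of "(- 1) ^ k"])
qed

text \<open>Both sides have the ratio (k+1/3)(k+2/3)/(k+1)^2 between consecutive terms; the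
  induction compares them after clearing (K+1)^2.\<close>

lemma gbinomial_minus_thirds:
  "((- 1/3 :: rat) gchoose k) * ((- 2/3) gchoose k) = fact (3 * k) / fact k ^ 3 / 27 ^ k"
proof (induction k)
  case (Suc k)
  define K where "K = (of_nat k :: rat)"
  have K: "K + 1 \<noteq> 0" unfolding K_def using of_nat_0_le_iff[where ?'a = rat, of k] by linarith
  have step: "(K + 1) * (a gchoose Suc k) = (a - K) * (a gchoose k)" for a
    using gbinomial_Suc_mult[of k a] by (simp add: K_def add.commute)
  have "(K + 1)\<^sup>2 * (((- 1/3 :: rat) gchoose Suc k) * ((- 2/3) gchoose Suc k))
      = ((K + 1) * ((- 1/3) gchoose Suc k)) * ((K + 1) * ((- 2/3) gchoose Suc k))"
    by (simp only: power2_eq_square mult_ac)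
  also have "\<dots> = (- 1/3 - K) * (- 2/3 - K) * (((- 1/3) gchoose k) * ((- 2/3) gchoose k))"
    unfolding step by (simp only: mult_ac)
  also have "\<dots> = (- 1/3 - K) * (- 2/3 - K) * (fact (3 * k) / fact k ^ 3 / 27 ^ k)"
    by (simp only: Suc)
  finally have 1: "(K + 1)\<^sup>2 * (((- 1/3 :: rat) gchoose Suc k) * ((- 2/3) gchoose Suc k)) = \<dots>" .
  have "fact (3 * Suc k) = (3 * (K + 1) * (3 * K + 2) * (3 * K + 1) * fact (3 * k) :: rat)"
    by (simp add: K_def numeral_3_eq_3 algebra_simps)
  moreover have "fact (Suc k) = ((K + 1) * fact k :: rat)" by (simp add: K_def)
  ultimately have "(K + 1)\<^sup>2 * (fact (3 * Suc k) / fact (Suc k) ^ 3 / 27 ^ Suc k)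
     = (K + 1)\<^sup>2 * (3 * (K + 1) * (3 * K + 2) * (3 * K + 1)) / ((K + 1) ^ 3 * 27) * (fact (3 * k) / fact k ^ 3 / 27 ^ k)"
    by (simp only: power_mult_distrib power_Suc times_divide_times_eq divide_divide_eq_left mult_ac times_divide_eq_left times_divide_eq_right)
  also have "(K + 1)\<^sup>2 * (3 * (K + 1) * (3 * K + 2) * (3 * K + 1)) / ((K + 1) ^ 3 * 27) = (- 1/3 - K) * (- 2/3 - K)"
    using K by (simp add: divide_simps) (simp add: algebra_simps power2_eq_square power3_eq_cube)
  finally have 2: "(K + 1)\<^sup>2 * (fact (3 * Suc k) / fact (Suc k) ^ 3 / 27 ^ Suc k) =
      (- 1/3 - K) * (- 2/3 - K) * (fact (3 * k) / fact k ^ 3 / 27 ^ k)" .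
  from 1[folded 2] K show ?case by (simp only: mult_cancel_left) auto
qed simp

section \<open>The binomial product congruence and cases a and b\<close>

context prime_localization
begin

lemma minus_one_power_Zp [simp, intro]: "(- 1) ^ n \<in> Zp"
  by (intro Zp_power Zp_uminus Zp_1)

text \<open>One factor of the falling factorial is divisible by p, while \<open>fact k\<close> is a
  unit.\<close>

lemma gbinomial_Ip_1:
  assumes "a \<in> Zp" "i < k" "k < p" "a - of_nat i \<in> Ip 1"
  shows "a gchoose k \<in> Ip 1"
proof -
  have "(\<Prod>j<k. a - of_nat j) = (a - of_nat i) * (\<Prod>j\<in>{..<k} - {i}. a - of_nat j)"
    using assms(2) by (subst prod.remove[of _ i]) auto
  also have "\<dots> \<in> Ip 1" using assms by (intro Ip_mult_Zp Zp_prod Zp_diff) auto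
  finally have "(\<Prod>j<k. a - of_nat j) \<in> Ip 1" .
  from Ip_mult_Zp[OF this Zp_divide_fact[OF Zp_1 assms(3)]] show ?thesis
    unfolding gbinomial_altdef_prod by simp
qed

text \<open>For k > 0 the factor p t / k splits off from C(pt,k), so the remaining product matters
  only modulo p, where it is C(-1,k-1) C(-1,k) = -1. What is left is a multiple of p times the
  harmonic sum, which is itself divisible by p.\<close>

lemma gbinomial_product_sum_base:
  assumes "odd p" "t \<in> Zp"
  shows "pcong 2 (\<Sum>k<p. ((of_nat p * t) gchoose k) * ((- 1 - of_nat p * t) gchoose k)) 1"
proof -
  let ?a = "of_nat p * t"
  have aZ: "?a \<in> Zp" using assms by auto
  have a0: "pcong 1 ?a 0" unfolding pcong_def using assms by (auto intro: IpI)
  have a1: "pcong 1 (?a - 1) (- 1)" "pcong 1 (- 1 - ?a) (- 1)"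
    using a0 unfolding pcong_def by auto
  have summand: "pcong 2 ((?a gchoose k) * ((- 1 - ?a) gchoose k)) (- ?a * (1 / of_nat k))"
    if k: "k \<in> {1..<p}" for k
  proof -
    have "pcong 1 (((?a - 1) gchoose (k - 1)) * ((- 1 - ?a) gchoose k)) ((- 1 gchoose (k - 1)) * (- 1 gchoose k))"
      using k by (intro pcong_mult gbinomial_pcong a1 gbinomial_Zp) (auto intro: aZ)
    also have "(- 1 gchoose (k - 1)) * (- 1 gchoose k) = (- 1 :: rat)"
      using k by (cases k) (auto simp: gbinomial_minus_one)
    finally have "((?a - 1) gchoose (k - 1)) * ((- 1 - ?a) gchoose k) - (- 1) \<in> Ip 1"
      unfolding pcong_def .
    then have "of_nat p * (((?a - 1) gchoose (k - 1)) * ((- 1 - ?a) gchoose k) - (- 1)) * (t / of_nat k) \<in> Ip 2"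
      using k assms by (intro Ip_mult_Zp[OF p_mult_Ip_1] Zp_divide_less) auto
    moreover have "?a gchoose k = (?a / of_nat k) * ((?a - 1) gchoose (k - 1))"
      using k by (intro gbinomial_absorption') auto
    ultimately show ?thesis
      unfolding pcong_def by (simp add: algebra_simps)
  qed
  have "{..<p} = insert 0 {1..<p}" using p_pos by auto
  then have "(\<Sum>k<p. (?a gchoose k) * ((- 1 - ?a) gchoose k))
      = 1 + (\<Sum>k = 1..<p. (?a gchoose k) * ((- 1 - ?a) gchoose k))" by simp
  also have "pcong 2 \<dots> (1 + (\<Sum>k = 1..<p. - ?a * (1 / of_nat k)))"
    by (intro pcong_add pcong_refl pcong_sum summand)
  also have "(\<Sum>k = 1..<p. - ?a * (1 / of_nat k)) = of_nat p * ((\<Sum>k = 1..<p. 1 / of_nat k) * (- t))"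
    by (simp add: sum_distrib_left sum_distrib_right algebra_simps sum_negf)
  also have "pcong 2 (1 + \<dots>) (1 + 0)"
    using p_mult_Ip_1[OF Ip_mult_Zp[OF sum_inverse_Ip[OF assms(1)] Zp_uminus[OF assms(2)]]]
    by (intro pcong_add pcong_refl) (simp only: pcong_def diff_0_right)
  finally show ?thesis by simp
qed

lemma gbinomial_product_sum:
  assumes "odd p" "t \<in> Zp" "r < p"
  shows "pcong 2 (\<Sum>k<p. ((of_nat r + of_nat p * t) gchoose k) * ((- 1 - (of_nat r + of_nat p * t)) gchoose k)) ((- 1) ^ r)"
  using assms(3)
proof (induction r)
  case 0
  then show ?case using gbinomial_product_sum_base[OF assms(1,2)] by simp
next
  case (Suc r)
  define a where "a = of_nat (Suc r) + of_nat p * t"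
  have aZ: "a \<in> Zp" unfolding a_def using assms by auto
  have a1: "a - 1 = of_nat r + of_nat p * t" "- 1 - (a - 1) = - a" by (auto simp: a_def)
  define n where "n = p - 1"
  have n: "Suc n = p" "n < p" "r < n" using p_pos Suc.prems by (auto simp: n_def)
  have a1Z: "a - 1 \<in> Zp" "- a - 1 \<in> Zp" using aZ by auto
  have pt: "of_nat p * x \<in> Ip 1" if "x \<in> Zp" for x using that by (intro IpI[of x]) auto
  \<comment> \<open>The numerator contains the factor a - 1 - r = p t, at position r < p -
    1.\<close>
  have "(a - 1) gchoose n \<in> Ip 1"
  proof (rule gbinomial_Ip_1[OF a1Z(1) n(3,2)])
    show "a - 1 - of_nat r \<in> Ip 1" using pt[OF assms(2)] unfolding a1 by simp
  qed
  \<comment> \<open>Here the vanishing factor sits at position p - r - 2, where it equals p (-1 -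
    t).\<close>
  moreover have "(- a - 1) gchoose n \<in> Ip 1"
  proof (rule gbinomial_Ip_1[OF a1Z(2) _ n(2)])
    show "n - Suc r < n" using n by simp
    have "(of_nat n :: rat) = of_nat p - 1" unfolding n(1)[symmetric] by simp
    then have "- a - 1 - of_nat (n - Suc r) = of_nat p * (- 1 - t)"
      using n(3) by (simp add: a_def of_nat_diff algebra_simps)
    moreover have "- 1 - t \<in> Zp" using assms by auto
    ultimately show "- a - 1 - of_nat (n - Suc r) \<in> Ip 1" by (simp only: pt)
  qed
  ultimately have "2 * (((a - 1) gchoose n) * ((- a - 1) gchoose n)) \<in> Ip 2"
    by (intro Zp_mult_Ip Ip_1_mult) auto
  moreover have "{..<p} = {..n}" using n by auto
  ultimately have "(\<Sum>k<p. (a gchoose k) * ((- 1 - a) gchoose k)) + (\<Sum>k<p. ((a - 1) gchoose k) * ((- a) gchoose k)) \<in> Ip 2"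
    by (simp only: gbinomial_product_sum_recurrence mult.assoc)
  moreover have "(\<Sum>k<p. ((a - 1) gchoose k) * ((- a) gchoose k)) - (- 1) ^ r \<in> Ip 2"
    using Suc.IH Suc.prems unfolding a1(1)[symmetric] a1(2) pcong_def by simp
  ultimately have "(\<Sum>k<p. (a gchoose k) * ((- 1 - a) gchoose k)) + (\<Sum>k<p. ((a - 1) gchoose k) * ((- a) gchoose k))
      - ((\<Sum>k<p. ((a - 1) gchoose k) * ((- a) gchoose k)) - (- 1) ^ r) \<in> Ip 2"
    by (rule Ip_diff)
  then have "(\<Sum>k<p. (a gchoose k) * ((- 1 - a) gchoose k)) - (- 1) ^ Suc r \<in> Ip 2"
    by simp
  then show ?case unfolding pcong_def a_def .
qed

lemma odd_half: "odd p \<Longrightarrow> p = 2 * ((p - 1) div 2) + 1"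
  by (auto elim!: oddE)

lemma not_dvd_power_2: "odd p \<Longrightarrow> \<not> p dvd 2 ^ k"
  using prime_dvd_power[OF prime_p] primes_dvd_imp_eq[OF prime_p two_is_prime_nat] by blast

lemma Zp_divide_power_2: "odd p \<Longrightarrow> x \<in> Zp \<Longrightarrow> x / 2 ^ k \<in> Zp"
  using Zp_divide_nat[OF _ not_dvd_power_2, of x k] by simp

lemma half_Zp: "odd p \<Longrightarrow> - 1/2 \<in> Zp"
  using Zp_uminus[OF Zp_divide_power_2[OF _ Zp_1, of 1]] by simp

text \<open>The case x = -1/2 = h + p (-1/2) with h = (p-1)/2; since -1 - x = x, the products are
  squares.\<close>

lemma truncated_half_sum:
  assumes "odd p"
  shows "pcong 2 (\<Sum>k<p. ((- 1/2) gchoose k)\<^sup>2) ((- 1) ^ ((p - 1) div 2))"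
proof -
  define h where "h = (p - 1) div 2"
  have "- 1/2 = of_nat h + of_nat p * (- 1/2 :: rat)"
    using odd_half[OF assms] unfolding h_def[symmetric] by (simp add: field_simps)
  moreover have "h < p" using odd_half[OF assms] unfolding h_def by linarith
  moreover have "- 1 - (- 1/2) = (- 1/2 :: rat)" by simp
  ultimately show ?thesis
    using gbinomial_product_sum[OF assms half_Zp[OF assms], of h] unfolding h_def[symmetric]
    by (simp only: power2_eq_square)
qed

lemma truncated_series_a:
  assumes "odd p"
  shows "pcong 2 (truncated_series seq_a p (1/16)) ((- 1) ^ ((p - 1) div 2))"
proof -
  have "{0..p - 1} = {..<p}" using p_pos by auto
  then have "truncated_series seq_a p (1/16) = (\<Sum>k<p. ((- 1/2) gchoose k)\<^sup>2)"
    unfolding truncated_series_def seq_a_def gbinomial_minus_half_square by (simp add: power_divide)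
  then show ?thesis using truncated_half_sum[OF assms] by simp
qed

text \<open>The case x = -1/3. Its residue is (p-1)/3 if p = 1 modulo 3, which is even because p is
  odd, and otherwise (2p-1)/3, which is odd.\<close>

lemma truncated_series_b:
  assumes "odd p" "p mod 3 \<noteq> 0"
  shows "pcong 2 (truncated_series seq_b p (1/27)) (if p mod 3 = 1 then 1 else - 1)"
proof -
  have "{0..p - 1} = {..<p}" using p_pos by auto
  then have eq: "truncated_series seq_b p (1/27) = (\<Sum>k<p. ((- 1/3) gchoose k) * ((- 2/3) gchoose k))"
    unfolding truncated_series_def seq_b_def gbinomial_minus_thirds by (simp add: power_divide)
  have n3: "\<not> p dvd 3"
    using assms(2) primes_dvd_imp_eq[OF prime_p, of 3] by auto
  have third: "- of_nat m / 3 \<in> Zp" for m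
    using Zp_divide_nat[OF Zp_uminus[OF Zp_of_nat] n3] by simp
  show ?thesis
  proof (cases "p mod 3 = 1")
    case True
    define r where "r = p div 3"
    have p: "p = 3 * r + 1" using True unfolding r_def by presburger
    with assms(1) have "even r" by simp
    have e: "- 1/3 = of_nat r + of_nat p * (- of_nat 1 / 3 :: rat)" "- 2/3 = - 1 - (- 1/3 :: rat)"
      by (simp_all add: p field_simps)
    have "r < p" using p by simp
    from gbinomial_product_sum[OF assms(1) third this, of 1]
    have "pcong 2 (\<Sum>k<p. ((- 1/3) gchoose k) * ((- 2/3) gchoose k)) ((- 1) ^ r)"
      unfolding e(1)[symmetric] e(2)[symmetric] .
    then show ?thesis using True \<open>even r\<close> unfolding eq by simp
  next
    case False
    define q where "q = p div 3"
    have p: "p = 3 * q + 2" using False assms(2) unfolding q_def by presburger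
    have e: "- 1/3 = of_nat (2 * q + 1) + of_nat p * (- of_nat 2 / 3 :: rat)" "- 2/3 = - 1 - (- 1/3 :: rat)"
      by (simp_all add: p field_simps)
    have "2 * q + 1 < p" using p by simp
    from gbinomial_product_sum[OF assms(1) third this, of 2]
    have "pcong 2 (\<Sum>k<p. ((- 1/3) gchoose k) * ((- 2/3) gchoose k)) ((- 1) ^ (2 * q + 1))"
      unfolding e(1)[symmetric] e(2)[symmetric] .
    then show ?thesis using False unfolding eq by simp
  qed
qed

end

section \<open>Sums over squares of central binomial coefficients\<close>

text \<open>Both sides satisfy the same recursion in N: by Pascal's rule the tail of a row doubles
  and gains C(N,m). The weight 1/2 is 4t at t = 1/8 in case f.\<close>

lemma sum_binomial_half_powers:
  "(\<Sum>k<N. of_nat (k choose m) * (1/2) ^ k) * 2 ^ N = (2 * (\<Sum>i\<in>{m<..N}. of_nat (N choose i)) :: rat)"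
proof (induction N)
  case (Suc N)
  have "(\<Sum>i\<in>{m<..Suc N}. of_nat (Suc N choose i)) = (\<Sum>i\<in>{m..N}. of_nat (Suc N choose Suc i) :: rat)"
    by (rule sum.reindex_bij_witness[of _ Suc "\<lambda>i. i - 1"]) auto
  also have "\<dots> = (\<Sum>i\<in>{m..N}. of_nat (N choose i)) + (\<Sum>i\<in>{m..N}. of_nat (N choose Suc i))"
    by (simp add: sum.distrib)
  also have "(\<Sum>i\<in>{m..N}. of_nat (N choose Suc i)) = (\<Sum>i\<in>{m<..Suc N}. of_nat (N choose i) :: rat)"
    by (rule sum.reindex_bij_witness[of _ "\<lambda>i. i - 1" Suc]) auto
  also have "\<dots> = (\<Sum>i\<in>{m<..N}. of_nat (N choose i))"
    by (rule sum.mono_neutral_right) auto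
  also have "(\<Sum>i\<in>{m..N}. of_nat (N choose i)) = of_nat (N choose m) + (\<Sum>i\<in>{m<..N}. of_nat (N choose i) :: rat)"
  proof (cases "m \<le> N")
    case True
    then have "{m..N} = insert m {m<..N}" by auto
    then show ?thesis by simp
  qed simp
  finally have "(\<Sum>i\<in>{m<..Suc N}. of_nat (Suc N choose i)) = of_nat (N choose m) + 2 * (\<Sum>i\<in>{m<..N}. of_nat (N choose i) :: rat)"
    by simp
  moreover have "(\<Sum>k<Suc N. of_nat (k choose m) * (1/2) ^ k) * 2 ^ Suc N
     = 2 * ((\<Sum>k<N. of_nat (k choose m) * (1/2) ^ k) * 2 ^ N) + 2 * (of_nat (N choose m) :: rat)"
    by (simp add: algebra_simps power_divide)
  ultimately show ?case unfolding Suc by simp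
qed simp

text \<open>After reflecting one of them, the two row tails given by the previous lemma are
  complementary, so together they make 2^N.\<close>

lemma sum_binomial_half_powers_symmetric:
  assumes "m < N"
  shows "(\<Sum>k<N. of_nat (k choose m) * (1/2) ^ k) + (\<Sum>k<N. of_nat (k choose (N - 1 - m)) * (1/2) ^ k) = (2 :: rat)"
proof -
  have "(\<Sum>i\<in>{N - 1 - m<..N}. of_nat (N choose i)) = (\<Sum>i\<in>{..m}. of_nat (N choose i) :: rat)"
    by (rule sum.reindex_bij_witness[of _ "\<lambda>i. N - i" "\<lambda>i. N - i"]) (use assms in \<open>auto simp: binomial_symmetric[symmetric]\<close>)
  moreover have "{..N} = {..m} \<union> {m<..N}" using assms by auto
  then have "(\<Sum>i\<le>N. of_nat (N choose i)) = (\<Sum>i\<in>{..m}. of_nat (N choose i)) + (\<Sum>i\<in>{m<..N}. of_nat (N choose i) :: rat)"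
    by (simp only:) (rule sum.union_disjoint, auto)
  moreover have "(\<Sum>i\<le>N. of_nat (N choose i)) = (2 ^ N :: rat)"
    using choose_row_sum[of N] by (metis of_nat_sum of_nat_power of_nat_numeral)
  ultimately have "((\<Sum>k<N. of_nat (k choose m) * (1/2) ^ k) + (\<Sum>k<N. of_nat (k choose (N - 1 - m)) * (1/2) ^ k)) * 2 ^ N = (2 * 2 ^ N :: rat)"
    unfolding distrib_right sum_binomial_half_powers by simp
  then show ?thesis by simp
qed

text \<open>The range of j no longer depends on k, so the sums over j and k can be exchanged; the
  powers of 4 are split so that j enters through C(-1/2,j)^2.\<close>

lemma seq_f_extended:
  assumes "k \<le> 2 * h + 1"
  shows "seq_f k * t ^ k = (\<Sum>j\<le>h. ((- 1/2) gchoose j)\<^sup>2 * (of_nat (k choose (2 * j)) * (4 * t) ^ k))"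
proof -
  have "seq_f k = (\<Sum>j\<le>h. 4 ^ (k - 2 * j) * of_nat (k choose (2 * j)) * of_nat ((2 * j) choose j) ^ 2)"
    unfolding seq_f_def by (rule sum.mono_neutral_left) (use assms in \<open>auto simp: binomial_eq_0\<close>)
  also have "\<dots> * t ^ k = (\<Sum>j\<le>h. ((- 1/2) gchoose j)\<^sup>2 * (of_nat (k choose (2 * j)) * (4 * t) ^ k))"
    unfolding sum_distrib_right
  proof (intro sum.cong refl)
    fix j
    show "4 ^ (k - 2 * j) * of_nat (k choose (2 * j)) * of_nat ((2 * j) choose j) ^ 2 * t ^ k
        = ((- 1/2) gchoose j)\<^sup>2 * (of_nat (k choose (2 * j)) * (4 * t) ^ k)"
    proof (cases "2 * j \<le> k")
      case True
      then have "(4 :: rat) ^ (k - 2 * j) = 4 ^ k / 16 ^ j"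
        by (simp add: power_diff power_mult)
      then show ?thesis unfolding gbinomial_minus_half_square by (simp add: power_mult_distrib)
    qed (simp add: binomial_eq_0)
  qed
  finally show ?thesis .
qed

section \<open>Case f at 1/4 and 1/8\<close>

context prime_localization
begin

lemma binomial_prime_minus_one_pcong:
  assumes "k < p"
  shows "pcong 1 (of_nat ((p - 1) choose k)) ((- 1) ^ k)"
proof -
  have "pcong 1 (of_nat (p - 1)) (- 1)"
    using p_pos p_in_Ip_1 by (simp add: pcong_def of_nat_diff)
  from gbinomial_pcong[OF this Zp_uminus[OF Zp_1] assms] show ?thesis
    by (simp add: gbinomial_minus_one binomial_gbinomial)
qed

text \<open>C(p,k+1) = (p/(k+1)) C(p-1,k), and the last factor is needed only modulo p. At k+1 = p
  the denominator is no unit, but both sides are then 1 because k is even.\<close>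

lemma binomial_prime_pcong:
  assumes "odd p" "k < p"
  shows "pcong 2 (of_nat (p choose Suc k)) (of_nat p * ((- 1) ^ k / of_nat (Suc k)))"
proof (cases "Suc k = p")
  case True
  then have "even k" using assms(1) by auto
  then show ?thesis using p_pos unfolding True by simp
next
  case False
  then have k: "0 < Suc k" "Suc k < p" using assms(2) by auto
  have "Suc k * (p choose Suc k) = p * ((p - 1) choose k)"
    using Suc_times_binomial_eq[of "p - 1" k] p_pos by (simp add: mult.commute)
  then have "of_nat (Suc k) * of_nat (p choose Suc k) = (of_nat p * of_nat ((p - 1) choose k) :: rat)"
    by (metis of_nat_mult)
  then have "(of_nat (p choose Suc k) :: rat) = of_nat p * of_nat ((p - 1) choose k) / of_nat (Suc k)"
    by (simp add: field_simps del: of_nat_Suc)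
  then have "of_nat (p choose Suc k) - of_nat p * ((- 1) ^ k / of_nat (Suc k))
      = of_nat p * ((of_nat ((p - 1) choose k) - (- 1) ^ k) / of_nat (Suc k) :: rat)"
    by (simp add: diff_divide_distrib algebra_simps)
  moreover have "(of_nat ((p - 1) choose k) - (- 1) ^ k) / of_nat (Suc k) \<in> Ip 1"
    using binomial_prime_minus_one_pcong[OF assms(2)] k nat_dvd_not_less[OF k]
    by (intro Ip_divide_nat) (auto simp: pcong_def)
  ultimately show ?thesis unfolding pcong_def by (simp only: p_mult_Ip_1)
qed

text \<open>With h = -1/2 + p/2 the squares (-1/2-i)^2 and the products (h-i)(-h-1-i) differ by
  exactly p^2/4. The linear terms in p cancel, which is why the congruence holds modulo the square
  of p.\<close>

lemma half_square_pcong: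
  assumes "odd p" "j < p"
  defines "h \<equiv> (p - 1) div 2"
  shows "pcong 2 (((- 1/2) gchoose j)\<^sup>2) ((- 1) ^ j * of_nat (h choose j) * of_nat ((h + j) choose j))"
proof -
  have hp: "(of_nat h :: rat) = - 1/2 + of_nat p / 2"
    using arg_cong[OF odd_half[OF assms(1)], of "of_nat :: nat \<Rightarrow> rat"]
    unfolding h_def[symmetric] by (simp add: field_simps)
  have quarter: "1/4 \<in> Zp" using Zp_divide_power_2[OF assms(1) Zp_1, of 2] by simp
  have "pcong 2 (((- 1/2) - of_nat i)\<^sup>2) ((of_nat h - of_nat i) * (- of_nat h - 1 - of_nat i))" for i
    unfolding pcong_def
    by (rule IpI[OF quarter]) (simp add: hp power2_eq_square field_simps)
  then have "pcong 2 (\<Prod>i<j. ((- 1/2) - of_nat i)\<^sup>2) (\<Prod>i<j. (of_nat h - of_nat i) * (- of_nat h - 1 - of_nat i))"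
    by (intro pcong_prod Zp_mult Zp_diff Zp_uminus Zp_of_nat Zp_1)
  then have "pcong 2 ((\<Prod>i<j. ((- 1/2) - of_nat i)\<^sup>2) / fact j / fact j)
      ((\<Prod>i<j. (of_nat h - of_nat i) * (- of_nat h - 1 - of_nat i)) / fact j / fact j)"
    using assms(2) by (intro pcong_divide_fact)
  also have "(\<Prod>i<j. ((- 1/2) - of_nat i)\<^sup>2) / fact j / fact j = ((- 1/2 :: rat) gchoose j)\<^sup>2"
    by (simp add: gbinomial_altdef_prod power2_eq_square prod.distrib)
  also have "(\<Prod>i<j. (of_nat h - of_nat i) * (- of_nat h - 1 - of_nat i)) / fact j / fact j
      = (of_nat h gchoose j) * ((- of_nat h - 1 :: rat) gchoose j)"
    by (simp add: gbinomial_altdef_prod prod.distrib)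
  also have "(- of_nat h - 1 :: rat) gchoose j = (- 1) ^ j * of_nat ((h + j) choose j)"
    using gbinomial_minus[of "of_nat h + 1 :: rat" j] by (simp add: binomial_gbinomial)
  finally show ?thesis by (simp add: binomial_gbinomial[symmetric] mult_ac)
qed

lemma truncated_series_f_eq:
  assumes "p = 2 * h + 1"
  shows "truncated_series seq_f p t =
    (\<Sum>j\<le>h. ((- 1/2) gchoose j)\<^sup>2 * (\<Sum>k<p. of_nat (k choose (2 * j)) * (4 * t) ^ k))"
proof -
  have "{0..p - 1} = {..<p}" using p_pos by auto
  then have "truncated_series seq_f p t = (\<Sum>k<p. seq_f k * t ^ k)"
    unfolding truncated_series_def by simp
  also have "\<dots> = (\<Sum>k<p. \<Sum>j\<le>h. ((- 1/2) gchoose j)\<^sup>2 * (of_nat (k choose (2 * j)) * (4 * t) ^ k))"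
    by (intro sum.cong refl seq_f_extended) (use assms in auto)
  also have "\<dots> = (\<Sum>j\<le>h. \<Sum>k<p. ((- 1/2) gchoose j)\<^sup>2 * (of_nat (k choose (2 * j)) * (4 * t) ^ k))"
    by (rule sum.swap)
  finally show ?thesis by (simp only: sum_distrib_left)
qed

text \<open>At t = 1/4 the sum over k is a column of Pascal's triangle, equal to C(p,2j+1). The two
  preceding congruences turn the whole into p times the alternating sum with denominators 2j+1,
  whose value is 1/p.\<close>

lemma truncated_series_f_quarter:
  assumes "odd p"
  shows "pcong 2 (truncated_series seq_f p (1/4)) 1"
proof -
  define h where "h = (p - 1) div 2"
  have h: "p = 2 * h + 1" unfolding h_def by (rule odd_half[OF assms])
  have col: "(\<Sum>k<p. of_nat (k choose m) * (4 * (1/4)) ^ k) = (of_nat (p choose Suc m) :: rat)" for m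
  proof -
    have "{..<p} = {0..p - 1}" using p_pos by auto
    then have "(\<Sum>k<p. k choose m) = p choose Suc m"
      using sum_choose_upper[of m "p - 1"] p_pos by (simp add: atLeast0AtMost)
    then show ?thesis by (simp flip: of_nat_sum)
  qed
  have "truncated_series seq_f p (1/4) = (\<Sum>j\<le>h. ((- 1/2) gchoose j)\<^sup>2 * of_nat (p choose Suc (2 * j)))"
    unfolding truncated_series_f_eq[OF h] col ..
  also have "pcong 2 \<dots> (\<Sum>j\<le>h. of_nat p * ((- 1) ^ j * of_nat (h choose j) * of_nat ((h + j) choose j) / of_nat (2 * j + 1)))"
  proof (rule pcong_sum)
    fix j assume "j \<in> {..h}"
    then have j: "2 * j < p" "j < p" using h by auto
    have "pcong 2 (((- 1/2) gchoose j)\<^sup>2 * of_nat (p choose Suc (2 * j)))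
       (((- 1/2) gchoose j)\<^sup>2 * (of_nat p * ((- 1) ^ (2 * j) / of_nat (Suc (2 * j)))))"
      using half_Zp[OF assms] j by (intro pcong_mult_left binomial_prime_pcong assms Zp_power gbinomial_Zp)
    also have "\<dots> = of_nat p / of_nat (2 * j + 1) * ((- 1/2) gchoose j)\<^sup>2" by simp
    also have "pcong 2 \<dots> (of_nat p / of_nat (2 * j + 1) * ((- 1) ^ j * of_nat (h choose j) * of_nat ((h + j) choose j)))"
    proof (intro pcong_mult_left half_square_pcong[OF assms j(2), folded h_def])
      show "of_nat p / of_nat (2 * j + 1) \<in> Zp"
      \<comment> \<open>At j = h the quotient is 1 and supplies no factor p; for this term
        \<open>half_square_pcong\<close> is needed to its full precision.\<close>
      proof (cases "2 * j + 1 = p")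
        case True
        then show ?thesis using p_pos by simp
      next
        case False
        then show ?thesis using j by (intro Zp_divide_less) auto
      qed
    qed
    finally show "pcong 2 (((- 1/2) gchoose j)\<^sup>2 * of_nat (p choose Suc (2 * j)))
        (of_nat p * ((- 1) ^ j * of_nat (h choose j) * of_nat ((h + j) choose j) / of_nat (2 * j + 1)))"
      by simp
  qed
  also have "\<dots> = of_nat p * (1 / of_nat (2 * h + 1))"
    unfolding sum_distrib_left[symmetric] alternating_sum_binomial_product_odd ..
  also have "\<dots> = 1" using p_pos unfolding h[symmetric] by simp
  finally show ?thesis .
qed

text \<open>The weights w are symmetric under j -> h-j modulo p, while T - 1 is divisible by p and
  antisymmetric. Symmetrizing the sum of w (T - 1) therefore leaves products of two multiples of p,
  so T may be replaced by 1.\<close>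

lemma truncated_series_f_eighth:
  assumes "odd p"
  shows "pcong 2 (truncated_series seq_f p (1/8)) ((- 1) ^ ((p - 1) div 2))"
proof -
  define h where "h = (p - 1) div 2"
  have h: "p = 2 * h + 1" unfolding h_def by (rule odd_half[OF assms])
  define T where "T = (\<lambda>j. \<Sum>k<p. of_nat (k choose (2 * j)) * (1/2) ^ k :: rat)"
  define w where "w = (\<lambda>j. ((- 1/2 :: rat) gchoose j)\<^sup>2)"
  have wZ: "w j \<in> Zp" if "j \<le> h" for j
    unfolding w_def using that h half_Zp[OF assms] by (intro Zp_power gbinomial_Zp) auto
  have T_sym: "T (h - j) = 2 - T j" if "j \<le> h" for j
    using sum_binomial_half_powers_symmetric[of "2 * j" p] that h
    by (simp add: T_def diff_mult_distrib2)
  \<comment> \<open>Modulo p only the entry i = p survives in the tail of row p, and 2^p reduces to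
    2.\<close>
  have T1: "T j - 1 \<in> Ip 1" if "j \<le> h" for j
  proof -
    have I: "(\<Sum>i\<in>{m<..<p}. of_nat (p choose i)) \<in> Ip 1" for m
      by (intro Ip_sum of_nat_Ip_1 dvd_choose_prime prime_p) auto
    have "{2 * j<..p} = insert p {2 * j<..<p}" using that h by auto
    then have 1: "T j * 2 ^ p = 2 * (1 + (\<Sum>i\<in>{2 * j<..<p}. of_nat (p choose i)))"
      unfolding T_def sum_binomial_half_powers by simp
    have "{..p} = insert 0 (insert p {0<..<p})" using p_pos by auto
    then have "(\<Sum>i\<le>p. of_nat (p choose i)) = 2 + (\<Sum>i\<in>{0<..<p}. of_nat (p choose i) :: rat)"
      using p_pos by simp
    moreover have "(\<Sum>i\<le>p. of_nat (p choose i)) = (2 ^ p :: rat)"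
      using choose_row_sum[of p] by (metis of_nat_sum of_nat_power of_nat_numeral)
    ultimately have 2: "2 ^ p = 2 + (\<Sum>i\<in>{0<..<p}. of_nat (p choose i) :: rat)" by simp
    have "of_nat (2 ^ p) * (T j - 1) = T j * 2 ^ p - 2 ^ p" by (simp add: algebra_simps)
    also have "\<dots> = 2 * (\<Sum>i\<in>{2 * j<..<p}. of_nat (p choose i)) - (\<Sum>i\<in>{0<..<p}. of_nat (p choose i))"
      unfolding 1 by (subst 2) simp
    also have "\<dots> \<in> Ip 1" using I by (intro Ip_diff Zp_mult_Ip) auto
    finally show ?thesis by (rule Ip_cancel_nat) (rule not_dvd_power_2[OF assms])
  qed
  \<comment> \<open>Modulo p, -1/2 may be replaced by h, and C(h,j) is symmetric.\<close>
  have w1: "w j - w (h - j) \<in> Ip 1" if "j \<le> h" for j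
  proof -
    have half: "pcong 1 (- 1/2) (of_nat h)"
      unfolding pcong_def by (rule IpI[OF half_Zp[OF assms]]) (simp add: h field_simps)
    have *: "pcong 1 (w i) ((of_nat (h choose i))\<^sup>2)" if "i \<le> h" for i
    proof -
      have "i < p" using that h by auto
      then show ?thesis
        unfolding w_def power2_eq_square binomial_gbinomial using half_Zp[OF assms]
        by (intro pcong_mult gbinomial_pcong half gbinomial_Zp Zp_of_nat)
    qed
    have "pcong 1 (w j) ((of_nat (h choose j))\<^sup>2)" using that by (rule *)
    also have "h choose j = h choose (h - j)" using that by (rule binomial_symmetric)
    also have "pcong 1 ((of_nat (h choose (h - j)))\<^sup>2) (w (h - j))" by (rule pcong_sym, rule *) simp
    finally show ?thesis unfolding pcong_def .
  qed
  have rev: "(\<Sum>j\<le>h. f (h - j)) = (\<Sum>j\<le>h. f j)" for f :: "nat \<Rightarrow> rat"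
    by (rule sum.reindex_bij_witness[of _ "\<lambda>j. h - j" "\<lambda>j. h - j"]) auto
  have "of_nat 2 * ((\<Sum>j\<le>h. w j * T j) - (\<Sum>j\<le>h. w j))
      = (\<Sum>j\<le>h. w j * T j) + (\<Sum>j\<le>h. w (h - j) * T (h - j)) - (\<Sum>j\<le>h. w j) - (\<Sum>j\<le>h. w (h - j))"
    unfolding rev[of w] rev[of "\<lambda>j. w j * T j"] by (simp add: algebra_simps)
  also have "\<dots> = (\<Sum>j\<le>h. (w j - w (h - j)) * (T j - 1))"
    unfolding sum.distrib[symmetric] sum_subtractf[symmetric]
    by (intro sum.cong refl) (simp add: T_sym algebra_simps)
  also have "\<dots> \<in> Ip 2" by (intro Ip_sum Ip_1_mult w1 T1) auto
  finally have "(\<Sum>j\<le>h. w j * T j) - (\<Sum>j\<le>h. w j) \<in> Ip 2"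
    by (rule Ip_cancel_nat) (use not_dvd_power_2[OF assms, of 1] in simp)
  moreover have "truncated_series seq_f p (1/8) = (\<Sum>j\<le>h. w j * T j)"
    unfolding truncated_series_f_eq[OF h] w_def T_def by simp
  ultimately have "pcong 2 (truncated_series seq_f p (1/8)) (\<Sum>j\<le>h. w j)"
    by (simp add: pcong_def)
  \<comment> \<open>For h < j < p the falling factorial contains -1/2 - h = -p/2, so the added
    squares vanish modulo p^2.\<close>
  also have "pcong 2 (\<Sum>j\<le>h. w j) (\<Sum>j<p. w j)"
  proof -
    have "w j \<in> Ip 2" if "j \<in> {h<..<p}" for j
    proof -
      have "- 1/2 - of_nat h \<in> Ip 1"
        by (rule IpI[OF half_Zp[OF assms]]) (simp add: h field_simps)
      then have "(- 1/2) gchoose j \<in> Ip 1"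
        using that by (intro gbinomial_Ip_1[OF half_Zp[OF assms], of h]) auto
      then show ?thesis unfolding w_def power2_eq_square by (intro Ip_1_mult)
    qed
    then have "(\<Sum>j\<in>{h<..<p}. w j) \<in> Ip 2" by (rule Ip_sum)
    then have "- (\<Sum>j\<in>{h<..<p}. w j) \<in> Ip 2" by (rule Ip_uminus)
    moreover have "(\<Sum>j<p. w j) = (\<Sum>j\<in>{..h} \<union> {h<..<p}. w j)"
      by (rule sum.cong) (use h in auto)
    then have "(\<Sum>j<p. w j) = (\<Sum>j\<le>h. w j) + (\<Sum>j\<in>{h<..<p}. w j)"
      by (subst (asm) sum.union_disjoint) auto
    ultimately show ?thesis by (simp only: pcong_def) simp
  qed
  also have "pcong 2 \<dots> ((- 1) ^ ((p - 1) div 2))"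
    unfolding w_def by (rule truncated_half_sum[OF assms])
  finally show ?thesis .
qed

end

section \<open>Franel numbers and the evaluations at -1 and 1\<close>

text \<open>The double sum of C(n,j)^2 C(j,i) C(j,n-i) is evaluated in both orders. Vandermonde over
  i gives C(n,j)^2 C(2j,n), which regroups into the right side; over j, after regrouping, it gives
  C(n,i)^3.\<close>

lemma franel_eq_sum_central_binomial:
  "(\<Sum>j\<le>n. (n choose j) ^ 3) = (\<Sum>j\<le>n. ((2 * j) choose j) * (n choose j) * (j choose (n - j)))"
proof -
  have 1: "((2 * j) choose j) * (n choose j) * (j choose (n - j))
      = (\<Sum>i\<le>n. ((n choose j) * (j choose i)) * ((n choose j) * (j choose (n - i))))"
    if "j \<le> n" for j
  proof -
    have "((2 * j) choose n) * (n choose j) = ((2 * j) choose j) * (j choose (n - j))"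
    proof (cases "n \<le> 2 * j")
      case True
      then show ?thesis using choose_mult[OF that True] by (simp add: mult_2)
    qed (use that in \<open>simp add: binomial_eq_0\<close>)
    moreover have "(\<Sum>i\<le>n. (j choose i) * (j choose (n - i))) = (2 * j) choose n"
      using vandermonde[of j j n] by (simp add: mult_2)
    moreover have "(\<Sum>i\<le>n. ((n choose j) * (j choose i)) * ((n choose j) * (j choose (n - i))))
        = (n choose j) * (n choose j) * (\<Sum>i\<le>n. (j choose i) * (j choose (n - i)))"
      by (simp only: sum_distrib_left mult_ac)
    ultimately show ?thesis by (simp only: mult_ac)
  qed
  have 2: "(\<Sum>j\<le>n. ((n choose j) * (j choose i)) * ((n choose j) * (j choose (n - i)))) = (n choose i) ^ 3"
    if i: "i \<le> n" for i
  proof -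
    have "(\<Sum>j\<le>n. ((n choose j) * (j choose i)) * ((n choose j) * (j choose (n - i))))
       = (\<Sum>j\<in>{i..n}. ((n choose j) * (j choose i)) * ((n choose j) * (j choose (n - i))))"
      by (rule sum.mono_neutral_right) (auto simp: binomial_eq_0)
    also have "\<dots> = (\<Sum>j\<in>{i..n}. (n choose i)\<^sup>2 * (((n - i) choose (j - i)) * (i choose (n - j))))"
    proof (intro sum.cong refl)
      fix j assume j: "j \<in> {i..n}"
      have a: "(n choose j) * (j choose i) = (n choose i) * ((n - i) choose (j - i))"
        using j by (intro choose_mult) auto
      have b: "(n choose j) * (j choose (n - i)) = (n choose i) * (i choose (n - j))"
      proof (cases "n - i \<le> j")
        case True
        have "(n choose j) * (j choose (n - i)) = (n choose (n - i)) * ((n - (n - i)) choose (j - (n - i)))"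
          using j True by (intro choose_mult) auto
        also have "n choose (n - i) = n choose i" using i by (simp add: binomial_symmetric[symmetric])
        also have "n - (n - i) = i" using i by simp
        also have "i choose (j - (n - i)) = i choose (i - (j - (n - i)))"
          using j i by (intro binomial_symmetric) auto
        also have "i - (j - (n - i)) = n - j" using j i True by auto
        finally show ?thesis .
      qed (use j i in \<open>simp add: binomial_eq_0\<close>)
      show "((n choose j) * (j choose i)) * ((n choose j) * (j choose (n - i)))
          = (n choose i)\<^sup>2 * (((n - i) choose (j - i)) * (i choose (n - j)))"
        unfolding a b by (simp only: power2_eq_square mult_ac)
    qed
    also have "\<dots> = (n choose i)\<^sup>2 * (\<Sum>j\<in>{i..n}. ((n - i) choose (j - i)) * (i choose (n - j)))"
      by (simp only: sum_distrib_left)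
    also have "(\<Sum>j\<in>{i..n}. ((n - i) choose (j - i)) * (i choose (n - j)))
        = (\<Sum>k\<le>n - i. ((n - i) choose k) * (i choose (n - i - k)))"
      by (rule sum.reindex_bij_witness[of _ "\<lambda>k. k + i" "\<lambda>j. j - i"]) (use i in auto)
    also have "\<dots> = n choose i"
      using vandermonde[of "n - i" i "n - i"] i by (simp add: binomial_symmetric[symmetric])
    finally show ?thesis by (simp add: power2_eq_square power3_eq_cube)
  qed
  have "(\<Sum>j\<le>n. ((2 * j) choose j) * (n choose j) * (j choose (n - j)))
      = (\<Sum>j\<le>n. \<Sum>i\<le>n. ((n choose j) * (j choose i)) * ((n choose j) * (j choose (n - i))))"
    by (intro sum.cong refl 1) auto
  also have "\<dots> = (\<Sum>i\<le>n. (n choose i) ^ 3)"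
    by (subst sum.swap) (intro sum.cong refl 2, auto)
  finally show ?thesis by simp
qed

lemma seq_c_altdef:
  assumes "k < N"
  shows "seq_c k = (\<Sum>j<N. of_nat ((2 * j) choose j) * (of_nat (k choose j) * of_nat (j choose (k - j))))"
proof -
  have "seq_c k = of_nat (\<Sum>j\<le>k. (k choose j) ^ 3)"
    by (simp add: seq_c_def atLeast0AtMost)
  also have "\<dots> = (\<Sum>j\<le>k. of_nat ((2 * j) choose j) * (of_nat (k choose j) * of_nat (j choose (k - j))))"
    unfolding franel_eq_sum_central_binomial by (simp add: mult.assoc)
  also have "\<dots> = (\<Sum>j<N. of_nat ((2 * j) choose j) * (of_nat (k choose j) * of_nat (j choose (k - j))))"
    by (rule sum.mono_neutral_left) (use assms in \<open>auto simp: binomial_eq_0\<close>)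
  finally show ?thesis .
qed

text \<open>Once c is expressed through central binomial coefficients, the sum over k of C(n,k)
  C(k,j) C(j,k-j) is a Vandermonde convolution with value C(n,j)^2.\<close>

lemma seq_d_eq_binomial_transform: "seq_d n = (\<Sum>k\<le>n. of_nat (n choose k) * seq_c k)"
proof -
  have vm: "(\<Sum>k\<le>n. (n choose k) * ((k choose j) * (j choose (k - j)))) = (n choose j)\<^sup>2"
    if j: "j \<le> n" for j
  proof -
    have "(\<Sum>k\<le>n. (n choose k) * ((k choose j) * (j choose (k - j))))
        = (\<Sum>k\<in>{j..n}. (n choose k) * ((k choose j) * (j choose (k - j))))"
      by (rule sum.mono_neutral_right) (auto simp: binomial_eq_0)
    also have "\<dots> = (\<Sum>k\<in>{j..n}. (n choose j) * ((j choose (k - j)) * ((n - j) choose (n - j - (k - j)))))"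
    proof (intro sum.cong refl)
      fix k assume k: "k \<in> {j..n}"
      have "(n choose k) * (k choose j) = (n choose j) * ((n - j) choose (k - j))"
        using k by (intro choose_mult) auto
      also have "(n - j) choose (k - j) = (n - j) choose (n - j - (k - j))"
        using k by (intro binomial_symmetric) auto
      finally have "(n choose k) * (k choose j) * (j choose (k - j))
          = (n choose j) * ((n - j) choose (n - j - (k - j))) * (j choose (k - j))" by (simp only:)
      then show "(n choose k) * ((k choose j) * (j choose (k - j)))
          = (n choose j) * ((j choose (k - j)) * ((n - j) choose (n - j - (k - j))))"
        by (simp only: mult.assoc mult.commute[of "j choose (k - j)"])
    qed
    also have "\<dots> = (n choose j) * (\<Sum>k\<in>{j..n}. (j choose (k - j)) * ((n - j) choose (n - j - (k - j))))"
      by (simp only: sum_distrib_left)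
    also have "(\<Sum>k\<in>{j..n}. (j choose (k - j)) * ((n - j) choose (n - j - (k - j))))
        = (\<Sum>i\<le>n - j. (j choose i) * ((n - j) choose (n - j - i)))"
      by (rule sum.reindex_bij_witness[of _ "\<lambda>i. i + j" "\<lambda>k. k - j"]) (use j in auto)
    also have "\<dots> = n choose j"
      using vandermonde[of j "n - j" "n - j"] j by (simp add: binomial_symmetric[symmetric])
    finally show ?thesis by (simp add: power2_eq_square)
  qed
  have "(\<Sum>k\<le>n. of_nat (n choose k) * seq_c k)
      = (\<Sum>k\<le>n. \<Sum>j<Suc n. of_nat ((2 * j) choose j) * of_nat ((n choose k) * ((k choose j) * (j choose (k - j)))))"
    by (intro sum.cong refl) (simp add: seq_c_altdef[of _ "Suc n"] sum_distrib_left mult_ac del: sum.lessThan_Suc)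
  also have "\<dots> = (\<Sum>j<Suc n. of_nat ((2 * j) choose j) * of_nat (\<Sum>k\<le>n. (n choose k) * ((k choose j) * (j choose (k - j)))))"
    by (subst sum.swap) (simp add: sum_distrib_left del: sum.lessThan_Suc)
  also have "\<dots> = (\<Sum>j<Suc n. of_nat ((2 * j) choose j) * of_nat ((n choose j)\<^sup>2))"
    by (intro sum.cong refl) (simp only: vm lessThan_iff less_Suc_eq_le)
  also have "\<dots> = seq_d n"
    unfolding seq_d_def lessThan_Suc_atMost atLeast0AtMost by (simp add: mult.commute)
  finally show ?thesis ..
qed

text \<open>Exchanging the sums leaves (1 - 1)^(n-k) as coefficient of a k. It recovers c from its
  binomial transform d.\<close>

lemma binomial_inversion:
  fixes a b :: "nat \<Rightarrow> 'a :: comm_ring_1"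
  assumes b: "\<And>n. b n = (\<Sum>k\<le>n. of_nat (n choose k) * a k)"
  shows "(\<Sum>j\<le>n. of_nat (n choose j) * (- 1) ^ (n - j) * b j) = a n"
proof -
  have b': "b j = (\<Sum>k\<le>n. of_nat (j choose k) * a k)" if "j \<le> n" for j
    unfolding b by (rule sum.mono_neutral_left) (use that in \<open>auto simp: binomial_eq_0\<close>)
  have inner: "(\<Sum>j\<le>n. of_nat (n choose j) * (- 1) ^ (n - j) * of_nat (j choose k)) = (if k = n then 1 else 0 :: 'a)"
    if k: "k \<le> n" for k
  proof -
    have "(\<Sum>j\<le>n. of_nat (n choose j) * (- 1) ^ (n - j) * of_nat (j choose k))
        = (\<Sum>j\<in>{k..n}. of_nat (n choose j) * (- 1) ^ (n - j) * of_nat (j choose k) :: 'a)"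
      by (rule sum.mono_neutral_right) (auto simp: binomial_eq_0)
    also have "\<dots> = (\<Sum>j\<in>{k..n}. of_nat (n choose k) * (of_nat ((n - k) choose (j - k)) * 1 ^ (j - k) * (- 1) ^ (n - k - (j - k))))"
    proof (intro sum.cong refl)
      fix j assume j: "j \<in> {k..n}"
      then have "(n choose j) * (j choose k) = (n choose k) * ((n - k) choose (j - k))"
        by (intro choose_mult) auto
      then have "of_nat (n choose j) * of_nat (j choose k) = (of_nat (n choose k) * of_nat ((n - k) choose (j - k)) :: 'a)"
        by (metis of_nat_mult)
      then have "of_nat (n choose j) * of_nat (j choose k) * (- 1) ^ (n - j)
          = (of_nat (n choose k) * of_nat ((n - k) choose (j - k)) * (- 1) ^ (n - j) :: 'a)"
        by (simp only:)
      moreover have "n - k - (j - k) = n - j" using j by auto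
      ultimately show "of_nat (n choose j) * (- 1) ^ (n - j) * of_nat (j choose k)
          = (of_nat (n choose k) * (of_nat ((n - k) choose (j - k)) * 1 ^ (j - k) * (- 1) ^ (n - k - (j - k))) :: 'a)"
        by (simp only: power_one mult_1_right mult.assoc mult.commute[of "of_nat (j choose k)"])
    qed
    also have "\<dots> = of_nat (n choose k) * (\<Sum>j\<in>{k..n}. of_nat ((n - k) choose (j - k)) * 1 ^ (j - k) * (- 1) ^ (n - k - (j - k)))"
      by (simp only: sum_distrib_left)
    also have "(\<Sum>j\<in>{k..n}. of_nat ((n - k) choose (j - k)) * 1 ^ (j - k) * (- 1) ^ (n - k - (j - k)))
       = (\<Sum>i\<le>n - k. of_nat ((n - k) choose i) * 1 ^ i * (- 1 :: 'a) ^ (n - k - i))"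
      by (rule sum.reindex_bij_witness[of _ "\<lambda>i. i + k" "\<lambda>j. j - k"]) (use k in auto)
    also have "\<dots> = (1 + - 1) ^ (n - k)" by (rule binomial_ring[symmetric])
    finally show ?thesis using k by (auto simp: power_0_left)
  qed
  have "(\<Sum>j\<le>n. of_nat (n choose j) * (- 1) ^ (n - j) * b j)
      = (\<Sum>j\<le>n. \<Sum>k\<le>n. of_nat (n choose j) * (- 1) ^ (n - j) * of_nat (j choose k) * a k)"
    by (intro sum.cong refl) (simp add: b' sum_distrib_left mult.assoc)
  also have "\<dots> = (\<Sum>k\<le>n. (\<Sum>j\<le>n. of_nat (n choose j) * (- 1) ^ (n - j) * of_nat (j choose k)) * a k)"
    by (subst sum.swap) (simp add: sum_distrib_right)
  also have "\<dots> = (\<Sum>k\<le>n. if k = n then a k else 0)"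
    by (intro sum.cong refl) (auto simp: inner)
  also have "\<dots> = a n" by simp
  finally show ?thesis .
qed

section \<open>The nontrivial character modulo 3 and sums of central binomial coefficients\<close>

definition chi3 :: "int \<Rightarrow> rat" where
  "chi3 m = (if m mod 3 = 0 then 0 else if m mod 3 = 1 then 1 else - 1)"

text \<open>The trace of 1 + w + w^2 = 0 for a primitive cube root of unity w, since chi3 m is
  proportional to w^m - w^(-m).\<close>

lemma chi3_sum_three: "chi3 (m + 1) + chi3 m + chi3 (m - 1) = 0"
proof -
  have "m mod 3 = 0 \<or> m mod 3 = 1 \<or> m mod 3 = 2" by presburger
  moreover have "m mod 3 = 0 \<Longrightarrow> (m + 1) mod 3 = 1 \<and> (m - 1) mod 3 = 2"
    "m mod 3 = 1 \<Longrightarrow> (m + 1) mod 3 = 2 \<and> (m - 1) mod 3 = 0"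
    "m mod 3 = 2 \<Longrightarrow> (m + 1) mod 3 = 0 \<and> (m - 1) mod 3 = 1" by presburger+
  ultimately show ?thesis unfolding chi3_def by auto
qed

lemma chi3_minus: "chi3 (- m) = - chi3 m"
proof -
  have "m mod 3 = 0 \<or> m mod 3 = 1 \<or> m mod 3 = 2" by presburger
  moreover have "m mod 3 = 0 \<Longrightarrow> (- m) mod 3 = 0"
    "m mod 3 = 1 \<Longrightarrow> (- m) mod 3 = 2" "m mod 3 = 2 \<Longrightarrow> (- m) mod 3 = 1" by presburger+
  ultimately show ?thesis unfolding chi3_def by auto
qed

lemma chi3_small [simp]: "chi3 0 = 0" "chi3 1 = 1" "chi3 (- 1) = - 1"
  by (simp_all add: chi3_def)

lemma sum_Suc_choose:
  fixes f :: "nat \<Rightarrow> rat"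
  shows "(\<Sum>k\<le>Suc m. f k * of_nat (Suc n choose k))
    = (\<Sum>k\<le>Suc m. f k * of_nat (n choose k)) + (\<Sum>k\<le>m. f (Suc k) * of_nat (n choose k))"
proof -
  have "(\<Sum>k\<le>Suc m. f k * of_nat (Suc n choose k)) = f 0 + (\<Sum>k\<le>m. f (Suc k) * of_nat (Suc n choose Suc k))"
    by (subst sum.atMost_Suc_shift) simp
  also have "(\<Sum>k\<le>m. f (Suc k) * of_nat (Suc n choose Suc k))
      = (\<Sum>k\<le>m. f (Suc k) * of_nat (n choose Suc k)) + (\<Sum>k\<le>m. f (Suc k) * of_nat (n choose k))"
    by (simp add: sum.distrib distrib_left)
  also have "f 0 + \<dots> = (f 0 * of_nat (n choose 0) + (\<Sum>k\<le>m. f (Suc k) * of_nat (n choose Suc k))) + (\<Sum>k\<le>m. f (Suc k) * of_nat (n choose k))"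
    by simp
  also have "f 0 * of_nat (n choose 0) + (\<Sum>k\<le>m. f (Suc k) * of_nat (n choose Suc k))
      = (\<Sum>k\<le>Suc m. f k * of_nat (n choose k))"
    by (rule sum.atMost_Suc_shift[symmetric])
  finally show ?thesis .
qed

text \<open>Pascal's rule adds \<open>chi3\<close> at two consecutive arguments, which is minus its
  value at the third; hence one sign and one shift per row.\<close>

lemma sum_chi3_choose: "(\<Sum>k\<le>n. chi3 (a + int k) * of_nat (n choose k)) = (- 1) ^ n * chi3 (a - int n)"
proof (induction n arbitrary: a)
  case (Suc n)
  have "(\<Sum>k\<le>Suc n. chi3 (a + int k) * of_nat (Suc n choose k))
      = (\<Sum>k\<le>n. chi3 (a + int k) * of_nat (n choose k)) + (\<Sum>k\<le>n. chi3 ((a + 1) + int k) * of_nat (n choose k))"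
    unfolding sum_Suc_choose by (simp add: add_ac)
  also have "\<dots> = (- 1) ^ n * (chi3 (a - int n) + chi3 (a + 1 - int n))"
    unfolding Suc by (simp add: algebra_simps)
  also have "chi3 (a - int n) + chi3 (a + 1 - int n) = - chi3 (a - int (Suc n))"
    using chi3_sum_three[of "a - int n"] by (simp add: algebra_simps)
  finally show ?case by simp
qed simp

text \<open>Two uses of Pascal's rule spread row 2n+2 over row 2n with \<open>chi3\<close> at three
  consecutive arguments, which cancel. One copy of the old sum and the new term C(2n,n)
  remain.\<close>

lemma sum_central_binomial_eq_chi3:
  "(\<Sum>k<n. of_nat ((2 * k) choose k)) = (\<Sum>k\<le>n. chi3 (int n - int k) * of_nat ((2 * n) choose k))"
proof (induction n)
  case (Suc n)
  have "(\<Sum>k\<le>Suc n. chi3 (int (Suc n) - int k) * of_nat ((2 * Suc n) choose k))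
      = (\<Sum>k\<le>Suc n. chi3 (int (Suc n) - int k) * of_nat (Suc (2 * n) choose k))
        + (\<Sum>k\<le>n. chi3 (int n - int k) * of_nat (Suc (2 * n) choose k))"
    using sum_Suc_choose[of "\<lambda>k. chi3 (int (Suc n) - int k)" "Suc (2 * n)" n] by simp
  also have "(\<Sum>k\<le>Suc n. chi3 (int (Suc n) - int k) * of_nat (Suc (2 * n) choose k))
      = (\<Sum>k\<le>n. chi3 (int n - int k + 1) * of_nat ((2 * n) choose k)) + (\<Sum>k\<le>n. chi3 (int n - int k) * of_nat ((2 * n) choose k))"
    using sum_Suc_choose[of "\<lambda>k. chi3 (int (Suc n) - int k)" "2 * n" n] by (simp add: algebra_simps)
  \<comment> \<open>The shifted sum ends at k = n-1. Extending it to k = n adds chi3 (-1) C(2n,n) =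
    -C(2n,n), and compensating for this produces the last summand.\<close>
  also have "(\<Sum>k\<le>n. chi3 (int n - int k) * of_nat (Suc (2 * n) choose k))
      = (\<Sum>k\<le>n. chi3 (int n - int k) * of_nat ((2 * n) choose k))
        + (\<Sum>k\<le>n. chi3 (int n - int k - 1) * of_nat ((2 * n) choose k)) + of_nat ((2 * n) choose n)"
  proof (cases n)
    case (Suc m)
    have "(\<Sum>k\<le>n. chi3 (int n - int k - 1) * of_nat ((2 * n) choose k))
        = (\<Sum>k\<le>m. chi3 (int n - int (Suc k)) * of_nat ((2 * n) choose k)) - of_nat ((2 * n) choose n)"
      unfolding Suc sum.atMost_Suc by (simp add: algebra_simps)
    moreover have "(\<Sum>k\<le>n. chi3 (int n - int k) * of_nat (Suc (2 * n) choose k))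
        = (\<Sum>k\<le>n. chi3 (int n - int k) * of_nat ((2 * n) choose k))
          + (\<Sum>k\<le>m. chi3 (int n - int (Suc k)) * of_nat ((2 * n) choose k))"
      using sum_Suc_choose[of "\<lambda>k. chi3 (int n - int k)" "2 * n" m] unfolding Suc by (simp only:)
    ultimately show ?thesis by simp
  qed simp
  also have "(\<Sum>k\<le>n. chi3 (int n - int k + 1) * of_nat ((2 * n) choose k)) + (\<Sum>k\<le>n. chi3 (int n - int k) * of_nat ((2 * n) choose k))
      + ((\<Sum>k\<le>n. chi3 (int n - int k) * of_nat ((2 * n) choose k))
        + (\<Sum>k\<le>n. chi3 (int n - int k - 1) * of_nat ((2 * n) choose k)) + of_nat ((2 * n) choose n))
      = (\<Sum>k\<le>n. (chi3 (int n - int k + 1) + chi3 (int n - int k) + chi3 (int n - int k - 1)) * of_nat ((2 * n) choose k))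
        + (\<Sum>k\<le>n. chi3 (int n - int k) * of_nat ((2 * n) choose k)) + of_nat ((2 * n) choose n)"
    by (simp add: sum.distrib algebra_simps)
  finally show ?case unfolding chi3_sum_three using Suc by simp
qed simp

section \<open>Congruences for central binomial sums and the values c(-1) and d(1)\<close>

context prime_localization
begin

lemma chi3_Zp [simp, intro]: "chi3 m \<in> Zp"
  unfolding chi3_def by (simp add: Zp_uminus)

lemma prime_dvd_choose_double:
  assumes "j < p" "p \<le> k" "k - j < p"
  shows "p dvd (k choose j)"
proof -
  have "fact j * fact (k - j) * (k choose j) = (fact k :: nat)"
    using assms by (intro binomial_fact_lemma) auto
  moreover have "p dvd (fact k :: nat)" using assms prime_p by (simp add: prime_dvd_fact_iff)
  ultimately have "p dvd fact j * fact (k - j) * (k choose j)" by simp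
  moreover have "\<not> p dvd fact j" "\<not> p dvd fact (k - j)"
    using assms prime_p by (simp_all add: prime_dvd_fact_iff)
  ultimately show ?thesis using prime_p by (auto simp: prime_dvd_mult_iff)
qed

text \<open>In Vandermonde's expansion every term but the two extreme ones is a product of two
  multiples of p.\<close>

lemma binomial_double_prime_pcong:
  assumes "0 < k" "k < p"
  shows "pcong 2 (of_nat ((2 * p) choose k)) (2 * of_nat (p choose k))"
proof -
  have "{..k} = insert 0 (insert k {0<..<k})" using assms by auto
  then have "(\<Sum>i\<le>k. (p choose i) * (p choose (k - i))) = 2 * (p choose k) + (\<Sum>i\<in>{0<..<k}. (p choose i) * (p choose (k - i)))"
    using assms by simp
  then have "(2 * p) choose k = 2 * (p choose k) + (\<Sum>i\<in>{0<..<k}. (p choose i) * (p choose (k - i)))"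
    using vandermonde[of p p k] by (simp add: mult_2)
  then have "of_nat ((2 * p) choose k) - 2 * of_nat (p choose k) = (\<Sum>i\<in>{0<..<k}. of_nat (p choose i) * of_nat (p choose (k - i)) :: rat)"
    by simp
  also have "\<dots> \<in> Ip 2"
    using assms by (intro Ip_sum Ip_1_mult of_nat_Ip_1 dvd_choose_prime prime_p) auto
  finally show ?thesis by (simp add: pcong_def)
qed

text \<open>Modulo p^2 the inner entries of row 2p are twice those of row p. The full
  \<open>chi3\<close> sum over row p equals chi3 p, which is already its term at k = 0, and the term
  at k = p is zero; so the inner part cancels.\<close>

lemma sum_central_binomial_pcong:
  assumes "odd p"
  shows "pcong 2 (\<Sum>k<p. of_nat ((2 * k) choose k)) (chi3 (int p))"
proof -
  have split: "(\<Sum>k\<le>p. f k) = f 0 + (\<Sum>k\<in>{0<..<p}. f k) + f p" for f :: "nat \<Rightarrow> rat"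
  proof -
    have "{..p} = insert 0 (insert p {0<..<p})" using p_pos by auto
    then show ?thesis using p_pos by simp
  qed
  have "(\<Sum>k\<le>p. chi3 (int p - int k) * of_nat (p choose k)) = (\<Sum>k\<le>p. chi3 (0 + int k) * of_nat (p choose k))"
    by (rule sum.reindex_bij_witness[of _ "\<lambda>k. p - k" "\<lambda>k. p - k"])
      (auto simp: binomial_symmetric[symmetric] of_nat_diff)
  also have "\<dots> = chi3 (int p)" unfolding sum_chi3_choose using assms chi3_minus[of "int p"] by simp
  finally have z: "(\<Sum>k\<in>{0<..<p}. chi3 (int p - int k) * of_nat (p choose k)) = 0"
    unfolding split by simp
  have "(\<Sum>k<p. of_nat ((2 * k) choose k)) = chi3 (int p) + (\<Sum>k\<in>{0<..<p}. chi3 (int p - int k) * of_nat ((2 * p) choose k))"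
    unfolding sum_central_binomial_eq_chi3 split by simp
  also have "pcong 2 \<dots> (chi3 (int p) + (\<Sum>k\<in>{0<..<p}. chi3 (int p - int k) * (2 * of_nat (p choose k))))"
    by (intro pcong_add pcong_refl pcong_sum pcong_mult_left binomial_double_prime_pcong) auto
  also have "(\<Sum>k\<in>{0<..<p}. chi3 (int p - int k) * (2 * of_nat (p choose k)))
      = 2 * (\<Sum>k\<in>{0<..<p}. chi3 (int p - int k) * of_nat (p choose k))"
    by (simp add: sum_distrib_left mult_ac)
  finally show ?thesis unfolding z by simp
qed

text \<open>After inserting the expression of \<open>seq_c k\<close> through central binomial coefficients, the sum over \<open>k\<close>
  may be extended beyond \<open>p\<close>: for \<open>p \<le> k \<le> 2 * j\<close> both \<open>C(2j,j)\<close> and \<open>C(k,j)\<close> are divisible by \<open>p\<close>.\<close>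

lemma seq_c_sum_pcong:
  assumes "\<And>k. p \<le> k \<Longrightarrow> k < 2 * p - 1 \<Longrightarrow> \<phi> k \<in> Zp"
  shows "pcong 2 (\<Sum>k<p. \<phi> k * seq_c k)
    (\<Sum>j<p. of_nat ((2 * j) choose j) * (\<Sum>i\<le>j. \<phi> (j + i) * of_nat (j choose i) * of_nat ((j + i) choose i)))"
proof -
  define c where "c = (\<lambda>j k. of_nat ((2 * j) choose j) * (of_nat (k choose j) * of_nat (j choose (k - j))) :: rat)"
  have "(\<Sum>k<p. \<phi> k * seq_c k) = (\<Sum>k<p. \<Sum>j<p. \<phi> k * c j k)"
    unfolding c_def by (intro sum.cong refl) (simp add: seq_c_altdef[of _ p] sum_distrib_left)
  also have "\<dots> = (\<Sum>j<p. \<Sum>k<p. \<phi> k * c j k)" by (rule sum.swap)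
  \<comment> \<open>The bound 2p-1 is the least one that admits k = 2j for every j < p.\<close>
  also have "pcong 2 \<dots> (\<Sum>j<p. \<Sum>k<2 * p - 1. \<phi> k * c j k)"
  proof (rule pcong_sum)
    fix j assume "j \<in> {..<p}"
    then have j: "j < p" by simp
    have "\<phi> k * c j k \<in> Ip 2" if k: "k \<in> {p..<2 * p - 1}" for k
    proof (cases "k \<le> 2 * j")
      case True
      have "p dvd (2 * j) choose j" "p dvd k choose j"
        using j k True by (auto intro!: prime_dvd_choose_double)
      then have "c j k \<in> Ip 2"
        unfolding c_def by (intro Ip_1_mult Ip_mult_Zp of_nat_Ip_1 Zp_of_nat)
      then show ?thesis using assms[of k] k by (intro Zp_mult_Ip) auto
    next
      case False
      then show ?thesis by (simp add: c_def binomial_eq_0)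
    qed
    then have "(\<Sum>k\<in>{p..<2 * p - 1}. \<phi> k * c j k) \<in> Ip 2" by (rule Ip_sum)
    then have "- (\<Sum>k\<in>{p..<2 * p - 1}. \<phi> k * c j k) \<in> Ip 2" by (rule Ip_uminus)
    moreover have "(\<Sum>k<2 * p - 1. \<phi> k * c j k) = (\<Sum>k<p. \<phi> k * c j k) + (\<Sum>k\<in>{p..<2 * p - 1}. \<phi> k * c j k)"
      unfolding lessThan_atLeast0 by (rule sum.atLeastLessThan_concat[symmetric]) (use p_pos in auto)
    ultimately show "pcong 2 (\<Sum>k<p. \<phi> k * c j k) (\<Sum>k<2 * p - 1. \<phi> k * c j k)"
      by (simp only: pcong_def) simp
  qed
  also have "(\<Sum>j<p. \<Sum>k<2 * p - 1. \<phi> k * c j k)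
      = (\<Sum>j<p. of_nat ((2 * j) choose j) * (\<Sum>i\<le>j. \<phi> (j + i) * of_nat (j choose i) * of_nat ((j + i) choose i)))"
  proof (intro sum.cong refl)
    fix j assume "j \<in> {..<p}"
    then have j: "j < p" by simp
    have "(\<Sum>k<2 * p - 1. \<phi> k * c j k) = (\<Sum>k\<in>{j..2 * j}. \<phi> k * c j k)"
      by (rule sum.mono_neutral_right) (use j in \<open>auto simp: c_def binomial_eq_0\<close>)
    also have "\<dots> = (\<Sum>i\<le>j. \<phi> (j + i) * c j (j + i))"
      by (rule sum.reindex_bij_witness[of _ "\<lambda>i. j + i" "\<lambda>k. k - j"]) auto
    also have "\<dots> = (\<Sum>i\<le>j. of_nat ((2 * j) choose j) * (\<phi> (j + i) * of_nat (j choose i) * of_nat ((j + i) choose i)))"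
    proof (intro sum.cong refl)
      fix i
      have "(j + i) choose j = (j + i) choose i" using binomial_symmetric[of j "j + i"] by simp
      then show "\<phi> (j + i) * c j (j + i) = of_nat ((2 * j) choose j) * (\<phi> (j + i) * of_nat (j choose i) * of_nat ((j + i) choose i))"
        by (simp add: c_def)
    qed
    finally show "(\<Sum>k<2 * p - 1. \<phi> k * c j k)
        = of_nat ((2 * j) choose j) * (\<Sum>i\<le>j. \<phi> (j + i) * of_nat (j choose i) * of_nat ((j + i) choose i))"
      by (simp only: sum_distrib_left)
  qed
  finally show ?thesis .
qed

text \<open>With weights (-1)^k every inner sum is 1, which leaves the sum of the central binomial
  coefficients.\<close>

lemma truncated_series_c_minus_one:
  assumes "odd p"
  shows "pcong 2 (truncated_series seq_c p (- 1)) (chi3 (int p))"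
proof -
  have "{0..p - 1} = {..<p}" using p_pos by auto
  then have "truncated_series seq_c p (- 1) = (\<Sum>k<p. (- 1) ^ k * seq_c k)"
    unfolding truncated_series_def by (simp add: mult.commute)
  also have "pcong 2 \<dots> (\<Sum>j<p. of_nat ((2 * j) choose j) * (\<Sum>i\<le>j. (- 1) ^ (j + i) * of_nat (j choose i) * of_nat ((j + i) choose i)))"
    by (rule seq_c_sum_pcong) auto
  also have "\<dots> = (\<Sum>j<p. of_nat ((2 * j) choose j))"
  proof (intro sum.cong refl)
    fix j
    have "(\<Sum>i\<le>j. (- 1) ^ (j + i) * of_nat (j choose i) * of_nat ((j + i) choose i))
        = (- 1) ^ j * (\<Sum>i\<le>j. (- 1) ^ i * of_nat (j choose i) * of_nat ((j + i) choose i) :: rat)"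
      by (simp only: sum_distrib_left power_add mult.assoc)
    also have "\<dots> = 1" unfolding alternating_sum_binomial_product by (simp flip: power_add)
    finally show "of_nat ((2 * j) choose j) * (\<Sum>i\<le>j. (- 1) ^ (j + i) * of_nat (j choose i) * of_nat ((j + i) choose i))
        = (of_nat ((2 * j) choose j) :: rat)" by simp
  qed
  also have "pcong 2 \<dots> (chi3 (int p))" by (rule sum_central_binomial_pcong[OF assms])
  finally show ?thesis .
qed

text \<open>Summing the binomial transform over n < p gives the weights C(p,k+1), replaced by p
  (-1)^k / (k+1). The inner sums then have the closed form with denominator 2j+1.\<close>

lemma truncated_series_d_one:
  assumes "odd p"
  shows "pcong 2 (truncated_series seq_d p 1) 1"
proof -
  define \<phi> where "\<phi> = (\<lambda>k. of_nat p * ((- 1) ^ k / of_nat (Suc k)) :: rat)"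
  have "{0..p - 1} = {..<p}" using p_pos by auto
  then have "truncated_series seq_d p 1 = (\<Sum>n<p. seq_d n)"
    unfolding truncated_series_def by simp
  also have "\<dots> = (\<Sum>n<p. \<Sum>k<p. of_nat (n choose k) * seq_c k)"
    unfolding seq_d_eq_binomial_transform
    by (intro sum.cong refl sum.mono_neutral_left) (auto simp: binomial_eq_0)
  also have "\<dots> = (\<Sum>k<p. of_nat (\<Sum>n<p. n choose k) * seq_c k)"
    by (subst sum.swap) (simp add: sum_distrib_right)
  also have "\<dots> = (\<Sum>k<p. of_nat (p choose Suc k) * seq_c k)"
  proof -
    have "{..<p} = {0..p - 1}" using p_pos by auto
    then have "(\<Sum>n<p. n choose k) = p choose Suc k" for k
      using sum_choose_upper[of k "p - 1"] p_pos by (simp add: atLeast0AtMost)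
    then show ?thesis by simp
  qed
  also have "pcong 2 \<dots> (\<Sum>k<p. \<phi> k * seq_c k)"
  proof (rule pcong_sum)
    fix k assume "k \<in> {..<p}"
    then have "pcong 2 (seq_c k * of_nat (p choose Suc k)) (seq_c k * \<phi> k)"
      unfolding \<phi>_def using assms
      by (intro pcong_mult_left binomial_prime_pcong) (auto simp: seq_c_def)
    then show "pcong 2 (of_nat (p choose Suc k) * seq_c k) (\<phi> k * seq_c k)"
      by (simp only: mult.commute)
  qed
  also have "pcong 2 \<dots> (\<Sum>j<p. of_nat ((2 * j) choose j) * (\<Sum>i\<le>j. \<phi> (j + i) * of_nat (j choose i) * of_nat ((j + i) choose i)))"
  proof (rule seq_c_sum_pcong)
    \<comment> \<open>Here k+1 lies strictly between p and 2p, so the weight is integral; this fails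
      at k = 2p-1, just outside the range.\<close>
    fix k assume k: "p \<le> k" "k < 2 * p - 1"
    have "\<not> p dvd Suc k"
    proof
      assume "p dvd Suc k"
      then have "p dvd Suc k - p" by (intro dvd_diff_nat) auto
      moreover have "0 < Suc k - p" "Suc k - p < p" using k by auto
      ultimately show False using nat_dvd_not_less by blast
    qed
    then show "\<phi> k \<in> Zp" unfolding \<phi>_def by (intro Zp_mult Zp_divide_nat) auto
  qed
  also have "\<dots> = (\<Sum>j<p. of_nat p / of_nat (2 * j + 1))"
  proof (intro sum.cong refl)
    fix j
    have "(\<Sum>i\<le>j. \<phi> (j + i) * of_nat (j choose i) * of_nat ((j + i) choose i))
        = of_nat p * (\<Sum>i\<le>j. (- 1) ^ (j + i) * of_nat (j choose i) * of_nat ((j + i) choose i) / of_nat (j + i + 1))"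
      unfolding \<phi>_def sum_distrib_left by (intro sum.cong refl) simp
    then have "of_nat ((2 * j) choose j) * (\<Sum>i\<le>j. \<phi> (j + i) * of_nat (j choose i) * of_nat ((j + i) choose i))
        = of_nat p * (of_nat ((2 * j) choose j) *
            (\<Sum>i\<le>j. (- 1) ^ (j + i) * of_nat (j choose i) * of_nat ((j + i) choose i) / of_nat (j + i + 1)))"
      by (simp only: mult_ac)
    also have "\<dots> = of_nat p / of_nat (2 * j + 1)"
      unfolding alternating_sum_binomial_product_shifted by simp
    finally show "of_nat ((2 * j) choose j) * (\<Sum>i\<le>j. \<phi> (j + i) * of_nat (j choose i) * of_nat ((j + i) choose i))
        = of_nat p / of_nat (2 * j + 1)" .
  qed
  also have "pcong 2 \<dots> 1" by (rule sum_inverse_odd_pcong[OF assms])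
  finally show ?thesis .
qed

end

section \<open>Three-term recurrences\<close>

text \<open>At n = 0 natural subtraction turns u (n - 1) into u 0, but its factor n^2 is
  zero.\<close>

definition apery_like :: "rat \<Rightarrow> rat \<Rightarrow> rat \<Rightarrow> (nat \<Rightarrow> rat) \<Rightarrow> bool" where
  "apery_like A B L u \<longleftrightarrow> (\<forall>n. (of_nat n + 1)\<^sup>2 * u (n + 1)
     = (A * of_nat n * (of_nat n + 1) + L) * u n - B * (of_nat n)\<^sup>2 * u (n - 1))"

lemma apery_like_scale:
  assumes "apery_like A B L u"
  shows "apery_like (y * A) (y\<^sup>2 * B) (y * L) (\<lambda>n. y ^ n * u n)"
  unfolding apery_like_def
proof
  fix n
  have *: "(of_nat n + 1)\<^sup>2 * u (n + 1) = (A * of_nat n * (of_nat n + 1) + L) * u n - B * (of_nat n)\<^sup>2 * u (n - 1)"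
    using assms by (simp add: apery_like_def)
  have pw: "y ^ (n + 1) = y * y ^ n" "(of_nat n)\<^sup>2 * y ^ (n + 1) = (of_nat n)\<^sup>2 * y\<^sup>2 * y ^ (n - 1)"
    by (cases n; simp add: power2_eq_square)+
  have "(of_nat n + 1)\<^sup>2 * (y ^ (n + 1) * u (n + 1)) = y ^ (n + 1) * ((of_nat n + 1)\<^sup>2 * u (n + 1))"
    by (simp only: mult_ac)
  also have "\<dots> = y ^ (n + 1) * ((A * of_nat n * (of_nat n + 1) + L) * u n) - B * ((of_nat n)\<^sup>2 * y ^ (n + 1)) * u (n - 1)"
    unfolding * by (simp only: right_diff_distrib mult_ac)
  also have "\<dots> = (y * A * of_nat n * (of_nat n + 1) + y * L) * (y ^ n * u n) - y\<^sup>2 * B * (of_nat n)\<^sup>2 * (y ^ (n - 1) * u (n - 1))"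
    unfolding pw(2) unfolding pw(1) by (simp add: algebra_simps)
  finally show "(of_nat n + 1)\<^sup>2 * (y ^ (n + 1) * u (n + 1))
      = (y * A * of_nat n * (of_nat n + 1) + y * L) * (y ^ n * u n) - y\<^sup>2 * B * (of_nat n)\<^sup>2 * (y ^ (n - 1) * u (n - 1))" .
qed

text \<open>Weighting the recurrence of \<open>u\<close> at index \<open>j\<close> by \<open>C(n,j) (-\<alpha>)^(n-j)\<close> and summing over \<open>j\<close>
  yields the new recurrence at index \<open>n\<close>.\<close>

lemma apery_like_binomial_transform:
  assumes u: "apery_like (\<alpha> + \<beta>) (\<alpha> * \<beta>) L u"
  shows "apery_like (\<beta> - 2 * \<alpha>) (\<alpha> * (\<alpha> - \<beta>)) (L - \<alpha>) (\<lambda>n. \<Sum>j\<le>n. of_nat (n choose j) * (- \<alpha>) ^ (n - j) * u j)"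
  unfolding apery_like_def
proof
  fix n
  define c where "c = (\<lambda>m j. of_nat (m choose j) * (- \<alpha>) ^ (m - j))"
  define N where "N = (of_nat n :: rat)"
  have ext: "(\<Sum>j\<le>m. c m j * u j) = (\<Sum>j\<le>n + 1. c m j * u j)" if "m \<le> n + 1" for m
    by (rule sum.mono_neutral_left) (use that in \<open>auto simp: c_def binomial_eq_0\<close>)
  \<comment> \<open>Comparison of the coefficients of u j: on the left the new recurrence acts on
    the row index n, on the right the adjoint of the old one acts on the column index j.\<close>
  have coeff: "(N + 1)\<^sup>2 * c (n + 1) j - ((\<beta> - 2 * \<alpha>) * N * (N + 1) + (L - \<alpha>)) * c n j + \<alpha> * (\<alpha> - \<beta>) * N\<^sup>2 * c (n - 1) j
      = (of_nat j)\<^sup>2 * c n (j - 1) - ((\<alpha> + \<beta>) * of_nat j * (of_nat j + 1) + L) * c n j + \<alpha> * \<beta> * (of_nat j + 1)\<^sup>2 * c n (j + 1)"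
    if j: "j \<le> n + 1" for j
  proof (cases "j = n + 1")
    case True
    then show ?thesis by (auto simp: c_def N_def binomial_eq_0)
  next
    case False
    with j have jn: "j \<le> n" by simp
    define J where "J = (of_nat j :: rat)"
    define y where "y = (- \<alpha>) ^ (n - j)"
    define C C1 C2 C3 C4 where defs: "C = (of_nat (n choose j) :: rat)" "C1 = (of_nat ((n + 1) choose j) :: rat)"
      "C2 = (of_nat (n choose (j - 1)) :: rat)" "C3 = (of_nat (n choose (j + 1)) :: rat)" "C4 = (of_nat ((n - 1) choose j) :: rat)"
    \<comment> \<open>After multiplication by N + 1 - J, and with the factors J + 1 and N already
      present, every binomial coefficient becomes a polynomial multiple of C(n,j).\<close>
    have nz: "N + 1 - J \<noteq> 0"
    proof -
      have "J \<le> N" unfolding J_def N_def using jn by simp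
      then show ?thesis by linarith
    qed
    have "(n + 1 - j) * ((n + 1) choose j) = (n + 1) * (n choose j)"
      using binomial_absorb_comp[of "n + 1" j] by simp
    then have 1: "(N + 1 - J) * C1 = (N + 1) * C"
      unfolding defs N_def J_def using jn by (metis (mono_tags) of_nat_diff of_nat_mult of_nat_add of_nat_1 trans_le_add1)
    have 2: "(N + 1 - J) * (J\<^sup>2 * C2) = J ^ 3 * C"
    proof (cases j)
      case (Suc i)
      have "Suc i * (n choose Suc i) = (n choose i) * (n - i)"
        using binomial_absorption[of i n] binomial_absorb_comp[of n i] by (simp add: mult.commute)
      then have "J * C = C2 * of_nat (n - i)"
        unfolding defs J_def Suc diff_Suc_1 by (metis of_nat_mult)
      moreover have "of_nat (n - i) = N + 1 - J"
        unfolding N_def J_def Suc using jn Suc by (simp add: of_nat_diff)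
      ultimately have "J * C = C2 * (N + 1 - J)" by (simp only:)
      then show ?thesis by (simp add: power2_eq_square power3_eq_cube mult_ac)
    qed (simp add: J_def)
    have "(j + 1) * (n choose (j + 1)) = (n - j) * (n choose j)"
      using binomial_absorption[of j n] binomial_absorb_comp[of n j] by simp
    then have 3: "(J + 1) * C3 = (N - J) * C"
      unfolding defs N_def J_def using jn by (metis of_nat_diff of_nat_mult of_nat_add of_nat_1)
    have "n * ((n - 1) choose j) = (n - j) * (n choose j)"
      using binomial_absorb_comp[of n j] by simp
    then have 4: "N * C4 = (N - J) * C"
      unfolding defs N_def J_def using jn by (metis of_nat_diff of_nat_mult)
    have c0: "c n j = C * y" by (simp add: c_def defs y_def)
    have c1: "c (n + 1) j = - \<alpha> * C1 * y" using jn by (simp add: c_def defs y_def Suc_diff_le)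
    have c2: "J\<^sup>2 * c n (j - 1) = - \<alpha> * (J\<^sup>2 * C2) * y"
    proof (cases j)
      case (Suc i)
      then have "n - i = Suc (n - j)" using jn by auto
      then show ?thesis using Suc by (simp add: c_def defs y_def)
    qed (simp add: J_def)
    \<comment> \<open>The truncated exponents are off by one at j = n; there both sides vanish, here
      through C(n,n+1) = 0 and in \<open>c4\<close> through C(n-1,n) = 0 or N = 0.\<close>
    have c3: "\<alpha> * c n (j + 1) = - C3 * y"
    proof (cases "j = n")
      case False
      then have "n - j = Suc (n - (j + 1))" using jn by auto
      then show ?thesis unfolding c_def defs y_def by simp
    qed (simp add: c_def defs binomial_eq_0)
    have c4: "\<alpha> * N * c (n - 1) j = - (N * C4) * y"
    proof (cases "j = n")
      case False
      then have "n - j = Suc (n - 1 - j)" using jn by auto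
      then show ?thesis unfolding c_def defs y_def by simp
    next
      case True
      then show ?thesis by (cases n) (simp_all add: c_def defs N_def binomial_eq_0)
    qed
    have "(N + 1 - J) * ((N + 1)\<^sup>2 * (- \<alpha> * C1 * y) - ((\<beta> - 2 * \<alpha>) * N * (N + 1) + (L - \<alpha>)) * (C * y) + (\<alpha> - \<beta>) * N * (- (N * C4) * y)
       - (- \<alpha> * (J\<^sup>2 * C2) * y - ((\<alpha> + \<beta>) * J * (J + 1) + L) * (C * y) + \<beta> * (J + 1) * (- ((J + 1) * C3) * y)))
      = - \<alpha> * y * (N + 1)\<^sup>2 * ((N + 1 - J) * C1) - (N + 1 - J) * ((\<beta> - 2 * \<alpha>) * N * (N + 1) + (L - \<alpha>)) * (C * y)
        - (N + 1 - J) * (\<alpha> - \<beta>) * N * (N * C4) * y + \<alpha> * y * ((N + 1 - J) * (J\<^sup>2 * C2))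
        + (N + 1 - J) * ((\<alpha> + \<beta>) * J * (J + 1) + L) * (C * y) + (N + 1 - J) * \<beta> * (J + 1) * ((J + 1) * C3) * y"
      by (simp add: algebra_simps)
    also have "\<dots> = 0"
      unfolding 1 2 3 4 by (simp add: algebra_simps power2_eq_square power3_eq_cube)
    finally have "(N + 1)\<^sup>2 * (- \<alpha> * C1 * y) - ((\<beta> - 2 * \<alpha>) * N * (N + 1) + (L - \<alpha>)) * (C * y) + (\<alpha> - \<beta>) * N * (- (N * C4) * y)
       = - \<alpha> * (J\<^sup>2 * C2) * y - ((\<alpha> + \<beta>) * J * (J + 1) + L) * (C * y) + \<beta> * (J + 1) * (- ((J + 1) * C3) * y)"
      using nz by (simp only: mult_eq_0_iff) simp
    moreover have "\<alpha> * (\<alpha> - \<beta>) * N\<^sup>2 * c (n - 1) j = (\<alpha> - \<beta>) * N * (\<alpha> * N * c (n - 1) j)"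
      by (simp only: power2_eq_square mult_ac)
    moreover have "\<alpha> * \<beta> * (J + 1)\<^sup>2 * c n (j + 1) = \<beta> * (J + 1) * ((J + 1) * (\<alpha> * c n (j + 1)))"
      by (simp only: power2_eq_square mult_ac)
    moreover have "(J + 1) * (- C3 * y) = - ((J + 1) * C3) * y" by (simp only: mult_minus_left mult_minus_right mult.assoc)
    ultimately show ?thesis
      unfolding J_def[symmetric] by (simp only: c0 c1 c2 c3 c4)
  qed
  have rec: "(of_nat j + 1)\<^sup>2 * u (j + 1) - ((\<alpha> + \<beta>) * of_nat j * (of_nat j + 1) + L) * u j + \<alpha> * \<beta> * (of_nat j)\<^sup>2 * u (j - 1) = 0" for j
    using u by (simp add: apery_like_def)
  \<comment> \<open>Summation by parts: \<open>s1\<close> and \<open>s2\<close> move the shifts from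
    c to u. The boundary terms vanish because of the factor j^2 at 0 and the zero binomial
    coefficients beyond n.\<close>
  have s1: "(\<Sum>j\<le>n + 1. (of_nat j)\<^sup>2 * c n (j - 1) * u j) = (\<Sum>j\<le>n + 1. c n j * ((of_nat j + 1)\<^sup>2 * u (j + 1)))"
  proof -
    have "(\<Sum>j\<le>n + 1. (of_nat j)\<^sup>2 * c n (j - 1) * u j) = (\<Sum>j\<le>n. c n j * ((of_nat j + 1)\<^sup>2 * u (j + 1)))"
      by (simp only: Suc_eq_plus1[symmetric] sum.atMost_Suc_shift) (simp add: algebra_simps)
    also have "\<dots> = (\<Sum>j\<le>n + 1. c n j * ((of_nat j + 1)\<^sup>2 * u (j + 1)))"
      by (simp add: c_def)
    finally show ?thesis .
  qed
  have s2: "(\<Sum>j\<le>n + 1. (of_nat j + 1)\<^sup>2 * c n (j + 1) * u j) = (\<Sum>j\<le>n + 1. c n j * ((of_nat j)\<^sup>2 * u (j - 1)))"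
  proof -
    have "(\<Sum>j\<le>n + 1. (of_nat j + 1)\<^sup>2 * c n (j + 1) * u j) = (\<Sum>j\<le>n. (of_nat j + 1)\<^sup>2 * c n (j + 1) * u j)"
      by (simp add: c_def)
    also have "\<dots> = (\<Sum>j\<le>n + 1. c n j * ((of_nat j)\<^sup>2 * u (j - 1)))"
      by (simp only: Suc_eq_plus1[symmetric] sum.atMost_Suc_shift) (simp add: algebra_simps)
    finally show ?thesis .
  qed
  have "(N + 1)\<^sup>2 * (\<Sum>j\<le>n + 1. c (n + 1) j * u j) - ((\<beta> - 2 * \<alpha>) * N * (N + 1) + (L - \<alpha>)) * (\<Sum>j\<le>n. c n j * u j)
      + \<alpha> * (\<alpha> - \<beta>) * N\<^sup>2 * (\<Sum>j\<le>n - 1. c (n - 1) j * u j)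
    = (\<Sum>j\<le>n + 1. ((N + 1)\<^sup>2 * c (n + 1) j - ((\<beta> - 2 * \<alpha>) * N * (N + 1) + (L - \<alpha>)) * c n j + \<alpha> * (\<alpha> - \<beta>) * N\<^sup>2 * c (n - 1) j) * u j)"
    by (subst ext[of n], simp, subst ext[of "n - 1"], simp)
      (simp only: sum_distrib_left sum.distrib[symmetric] sum_subtractf[symmetric] left_diff_distrib distrib_right mult.assoc)
  also have "\<dots> = (\<Sum>j\<le>n + 1. ((of_nat j)\<^sup>2 * c n (j - 1) - ((\<alpha> + \<beta>) * of_nat j * (of_nat j + 1) + L) * c n j + \<alpha> * \<beta> * (of_nat j + 1)\<^sup>2 * c n (j + 1)) * u j)"
    by (intro sum.cong refl) (simp only: coeff atMost_iff)
  also have "\<dots> = (\<Sum>j\<le>n + 1. (of_nat j)\<^sup>2 * c n (j - 1) * u j) - (\<Sum>j\<le>n + 1. c n j * (((\<alpha> + \<beta>) * of_nat j * (of_nat j + 1) + L) * u j))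
      + \<alpha> * \<beta> * (\<Sum>j\<le>n + 1. (of_nat j + 1)\<^sup>2 * c n (j + 1) * u j)"
    unfolding sum_distrib_left sum.distrib[symmetric] sum_subtractf[symmetric]
    by (intro sum.cong refl) (simp add: algebra_simps)
  also have "\<dots> = (\<Sum>j\<le>n + 1. c n j * ((of_nat j + 1)\<^sup>2 * u (j + 1) - ((\<alpha> + \<beta>) * of_nat j * (of_nat j + 1) + L) * u j + \<alpha> * \<beta> * (of_nat j)\<^sup>2 * u (j - 1)))"
    unfolding s1 s2 sum_distrib_left sum.distrib[symmetric] sum_subtractf[symmetric]
    by (intro sum.cong refl) (simp add: algebra_simps)
  also have "\<dots> = 0" unfolding rec by simp
  finally show "(of_nat n + 1)\<^sup>2 * (\<Sum>j\<le>n + 1. of_nat ((n + 1) choose j) * (- \<alpha>) ^ (n + 1 - j) * u j)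
      = ((\<beta> - 2 * \<alpha>) * of_nat n * (of_nat n + 1) + (L - \<alpha>)) * (\<Sum>j\<le>n. of_nat (n choose j) * (- \<alpha>) ^ (n - j) * u j)
        - \<alpha> * (\<alpha> - \<beta>) * (of_nat n)\<^sup>2 * (\<Sum>j\<le>n - 1. of_nat ((n - 1) choose j) * (- \<alpha>) ^ (n - 1 - j) * u j)"
    unfolding N_def c_def by linarith
qed

text \<open>Creative telescoping: applied to the summand, the recurrence gives G (k+1) - G k. The
  recurrences of c and e are derived from this one.\<close>

lemma apery_like_seq_d: "apery_like 10 9 3 seq_d"
  unfolding apery_like_def
proof
  fix n
  define N where "N = (of_nat n :: rat)"
  define b where "b = (\<lambda>k. of_nat ((2 * k) choose k) :: rat)"
  \<comment> \<open>the certificate found by Zeilberger's algorithm\<close>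
  define G where "G = (\<lambda>k. (3 * of_nat k - 4 * (N + 1)) * of_nat k * (of_nat (n choose (k - 1)))\<^sup>2 * b k)"
  define t where "t = (\<lambda>k. ((N + 1)\<^sup>2 * (of_nat ((n + 1) choose k))\<^sup>2 - (10 * N * (N + 1) + 3) * (of_nat (n choose k))\<^sup>2
      + 9 * N\<^sup>2 * (of_nat ((n - 1) choose k))\<^sup>2) * b k)"
  have ext: "seq_d m = (\<Sum>k<n + 2. (of_nat (m choose k))\<^sup>2 * b k)" if "m \<le> n + 1" for m
    unfolding seq_d_def b_def by (rule sum.mono_neutral_left) (use that in \<open>auto simp: binomial_eq_0\<close>)
  have telescope: "t k = G (Suc k) - G k" for k
  proof -
    define K where "K = (of_nat k :: rat)"
    define C where "C = (of_nat (n choose k) :: rat)"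
    have "(K + 1) * b (Suc k) = 2 * (2 * K + 1) * b k"
      using central_binomial_Suc[of k] by (simp add: b_def K_def add.commute)
    moreover have "G (Suc k) = (3 * K - 4 * N - 1) * C\<^sup>2 * ((K + 1) * b (Suc k))"
      unfolding G_def C_def by (simp add: K_def algebra_simps)
    ultimately have G1: "G (Suc k) = (3 * K - 4 * N - 1) * C\<^sup>2 * (2 * (2 * K + 1) * b k)"
      by (simp only:)
    have C4: "N * of_nat ((n - 1) choose k) = (N - K) * C"
    proof (cases "k \<le> n")
      case True
      have "n * ((n - 1) choose k) = (n - k) * (n choose k)"
        using binomial_absorb_comp[of n k] by simp
      then show ?thesis
        unfolding N_def K_def C_def using True by (metis of_nat_diff of_nat_mult)
    qed (simp add: C_def binomial_eq_0)
    have t: "t k = ((N + 1)\<^sup>2 * (of_nat ((n + 1) choose k))\<^sup>2 - (10 * N * (N + 1) + 3) * C\<^sup>2 + 9 * ((N - K) * C)\<^sup>2) * b k"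
      unfolding t_def C_def[symmetric] C4[symmetric] by (simp only: power_mult_distrib mult.assoc)
    show ?thesis
    proof (cases k)
      case 0
      then show ?thesis unfolding t G1 by (simp add: G_def K_def C_def b_def power2_eq_square algebra_simps)
    next
      case (Suc i)
      \<comment> \<open>For k > 0 both C(n+1,k) and C(n,k) are rational multiples of X = C(n,k-1),
        after which only a polynomial identity remains.\<close>
      define X where "X = (of_nat (n choose i) :: rat)"
      have K0: "K \<noteq> 0" by (simp add: K_def Suc)
      have "k * ((n + 1) choose k) = (n + 1) * (n choose i)"
        using Suc_times_binomial_eq[of n i] unfolding Suc by simp
      then have "K * of_nat ((n + 1) choose k) = (N + 1) * X"
        unfolding K_def N_def X_def by (metis of_nat_mult of_nat_add of_nat_1)
      then have P: "of_nat ((n + 1) choose k) = (N + 1) * X / K" using K0 by (simp add: field_simps)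
      have "K * C = (N + 1 - K) * X"
      proof (cases "i \<le> n")
        case True
        have "k * (n choose k) = (n - i) * (n choose i)"
          using binomial_absorption[of i n] binomial_absorb_comp[of n i] Suc by simp
        then have "K * C = (N - of_nat i) * X"
          unfolding K_def N_def X_def C_def using True by (metis of_nat_diff of_nat_mult)
        then show ?thesis by (simp add: K_def Suc)
      qed (simp add: C_def X_def Suc binomial_eq_0)
      then have Q: "C = (N + 1 - K) * X / K" using K0 by (simp add: field_simps)
      have Gk: "G k = (3 * K - 4 * (N + 1)) * K * X\<^sup>2 * b k"
        unfolding G_def K_def X_def Suc by simp
      show ?thesis
        unfolding t G1 Gk P Q using K0
        by (simp add: divide_simps power_divide power_mult_distrib) (simp add: algebra_simps power2_eq_square power4_eq_xxxx)
    qed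
  qed
  have "(\<Sum>k<n + 2. t k) = G (n + 2) - G 0"
    unfolding telescope by (rule sum_lessThan_telescope)
  also have "\<dots> = 0" by (simp add: G_def binomial_eq_0)
  finally have "(\<Sum>k<n + 2. t k) = 0" .
  moreover have "(\<Sum>k<n + 2. t k) = (N + 1)\<^sup>2 * seq_d (n + 1) - (10 * N * (N + 1) + 3) * seq_d n + 9 * N\<^sup>2 * seq_d (n - 1)"
    unfolding t_def by (subst (1 2 3) ext)
      (simp_all only: sum_distrib_left sum.distrib sum_subtractf left_diff_distrib distrib_right mult.assoc le_add1 order_refl le_diff_conv trans_le_add1)
  ultimately show "(of_nat n + 1)\<^sup>2 * seq_d (n + 1) = (10 * of_nat n * (of_nat n + 1) + 3) * seq_d n - 9 * (of_nat n)\<^sup>2 * seq_d (n - 1)"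
    unfolding N_def by linarith
qed

text \<open>Since 1 - 10t + 9t^2 = (1 - t)(1 - 9t), the transform with \<alpha> = 1 applies to d; it
  is the inverse binomial transform and returns c.\<close>

lemma apery_like_seq_c: "apery_like 7 (- 8) 2 seq_c"
proof -
  have "apery_like (1 + 9) (1 * 9) 3 seq_d" using apery_like_seq_d by simp
  from apery_like_binomial_transform[OF this] show ?thesis
    by (simp add: binomial_inversion[OF seq_d_eq_binomial_transform])
qed

text \<open>Since 1 - 7t - 8t^2 = (1 - 8t)(1 + t), the transform with \<alpha> = 8 applies to c;
  scaling by -1 adjusts the signs to those of e.\<close>

lemma apery_like_seq_e: "apery_like 17 72 6 seq_e"
proof -
  have "apery_like (8 + - 1) (8 * - 1) 2 seq_c" using apery_like_seq_c by simp
  from apery_like_scale[OF apery_like_binomial_transform[OF this], of "- 1"]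
  have "apery_like 17 72 6 (\<lambda>n. (- 1) ^ n * (\<Sum>j\<le>n. of_nat (n choose j) * (- 8) ^ (n - j) * seq_c j))"
    by simp
  also have "(\<lambda>n. (- 1) ^ n * (\<Sum>j\<le>n. of_nat (n choose j) * (- 8) ^ (n - j) * seq_c j)) = seq_e"
  proof
    fix n
    have "(- 1) ^ n * (of_nat (n choose j) * (- 8) ^ (n - j) * seq_c j)
        = (- 1) ^ j * 8 ^ (n - j) * of_nat (n choose j) * seq_c j" if "j \<le> n" for j
    proof -
      have "(- 8 :: rat) ^ (n - j) = (- 1) ^ (n - j) * 8 ^ (n - j)" by (rule power_minus)
      moreover have "(- 1 :: rat) ^ n * (- 1) ^ (n - j) = (- 1) ^ j"
        using that by (simp add: power_add[symmetric] minus_one_power_iff)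
      ultimately show ?thesis by (metis mult.assoc mult.commute)
    qed
    then have "(- 1) ^ n * (\<Sum>j\<le>n. of_nat (n choose j) * (- 8) ^ (n - j) * seq_c j)
        = (\<Sum>j\<le>n. (- 1) ^ j * 8 ^ (n - j) * of_nat (n choose j) * seq_c j)"
      unfolding sum_distrib_left by (intro sum.cong refl) (simp only: atMost_iff)
    also have "\<dots> = seq_e n" by (simp only: seq_e_def seq_c_def atLeast0AtMost)
    finally show "(- 1) ^ n * (\<Sum>j\<le>n. of_nat (n choose j) * (- 8) ^ (n - j) * seq_c j) = seq_e n" .
  qed
  finally show ?thesis .
qed

section \<open>The differential equation modulo the square of the prime\<close>

text \<open>Written in self-adjoint form, so that an affine substitution acts separately on the
  weight t (1 - A t + B t^2) and on the linear factor.\<close>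

definition apery_operator :: "rat \<Rightarrow> rat \<Rightarrow> rat \<Rightarrow> rat poly \<Rightarrow> rat poly" where
  "apery_operator A B L P = pderiv ([:0, 1, - A, B:] * pderiv P) + [:- L, B:] * P"

lemma coeff_apery_operator:
  "coeff (apery_operator A B L P) n = (of_nat n + 1)\<^sup>2 * coeff P (n + 1)
     - (A * of_nat n * (of_nat n + 1) + L) * coeff P n + B * (of_nat n)\<^sup>2 * coeff P (n - 1)"
proof (cases n)
  case 0
  then show ?thesis by (simp add: apery_operator_def coeff_pderiv coeff_pCons)
next
  case (Suc m)
  then show ?thesis
    by (cases m) (simp_all add: apery_operator_def coeff_pderiv coeff_pCons algebra_simps power2_eq_square)
qed

text \<open>By the chain rule each of the two derivatives contributes a factor b, whence b^2 in the
  condition on the weight and none in that on the linear factor.\<close>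

lemma apery_operator_pcompose:
  assumes "b \<noteq> 0"
    and w: "pcompose [:0, 1, - A, B:] [:a, b:] = smult (\<kappa> * b\<^sup>2) [:0, 1, - A', B':]"
    and l: "pcompose [:- L, B:] [:a, b:] = smult \<kappa> [:- L', B':]"
  shows "pcompose (apery_operator A B L P) [:a, b:] = smult \<kappa> (apery_operator A' B' L' (pcompose P [:a, b:]))"
proof -
  let ?q = "[:a, b:]"
  have d: "pderiv (pcompose P ?q) = smult b (pcompose (pderiv P) ?q)" for P
    by (simp add: pderiv_pcompose pderiv_pCons mult.commute)
  have "smult b (pcompose (pderiv ([:0, 1, - A, B:] * pderiv P)) ?q) = pderiv (pcompose ([:0, 1, - A, B:] * pderiv P) ?q)"
    by (simp only: d)
  also have "pcompose ([:0, 1, - A, B:] * pderiv P) ?q = smult (\<kappa> * b) ([:0, 1, - A', B':] * pderiv (pcompose P ?q))"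
    unfolding d pcompose_mult w
    by (simp only: mult_smult_left mult_smult_right smult_smult power2_eq_square mult.assoc)
  also have "pderiv \<dots> = smult b (smult \<kappa> (pderiv ([:0, 1, - A', B':] * pderiv (pcompose P ?q))))"
    by (simp only: pderiv_smult smult_smult mult.commute)
  finally have "pcompose (pderiv ([:0, 1, - A, B:] * pderiv P)) ?q = smult \<kappa> (pderiv ([:0, 1, - A', B':] * pderiv (pcompose P ?q)))"
    using assms(1) by (metis smult_cancel)
  then show ?thesis
    unfolding apery_operator_def pcompose_add
    by (simp only: pcompose_mult l smult_add_right mult_smult_left)
qed

context prime_localization
begin

lemma coeff_pcompose_Ip:
  assumes "\<And>i. coeff P i \<in> Ip n" "\<And>i. coeff q i \<in> Zp"
  shows "coeff (pcompose P q) i \<in> Ip n"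
  using assms(1)
proof (induction P arbitrary: i)
  case (pCons a P)
  have "coeff P i \<in> Ip n" for i using pCons.prems[of "Suc i"] by simp
  then have "coeff (pcompose P q) i \<in> Ip n" for i by (rule pCons.IH)
  moreover have "coeff [:a:] i \<in> Ip n" using pCons.prems[of 0] by (cases i) auto
  ultimately show ?case
    unfolding pcompose_pCons coeff_add coeff_mult by (intro Ip_add Ip_sum Zp_mult_Ip assms(2))
qed simp

text \<open>Cutting u at p disturbs the exact recurrence only in the coefficients p-1 and p, where
  the errors are -p^2 u(p) and p^2 B u(p-1).\<close>

lemma apery_operator_truncation:
  assumes rec: "apery_like A B L u" and Z: "\<And>n. u n \<in> Zp" "B \<in> Zp"
  defines "P \<equiv> (\<Sum>k<p. monom (u k) k)"
  shows "coeff (apery_operator A B L P) n \<in> Ip 2"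
proof -
  have c: "coeff P i = (if i < p then u i else 0)" for i
    unfolding P_def coeff_sum by (simp add: sum.delta)
  have u: "(of_nat n + 1)\<^sup>2 * u (n + 1) - (A * of_nat n * (of_nat n + 1) + L) * u n + B * (of_nat n)\<^sup>2 * u (n - 1) = 0" for n
    using rec by (simp add: apery_like_def)
  consider "n + 1 < p" | "n + 1 = p" | "n = p" | "n > p" by linarith
  then show ?thesis
  proof cases
    case 1
    then have "n < p" "n - 1 < p" by auto
    with 1 show ?thesis unfolding coeff_apery_operator c using u[of n] by simp
  next
    case 2
    then have "n < p" "n - 1 < p" by auto
    with 2 have "coeff (apery_operator A B L P) n = - ((of_nat n + 1)\<^sup>2 * u (n + 1))"
      unfolding coeff_apery_operator c using u[of n] by simp
    also have "of_nat n + 1 = (of_nat p :: rat)" unfolding 2[symmetric] by simp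
    finally show ?thesis by (intro IpI[of "- u (n + 1)"]) (use Z in auto)
  next
    case 3
    then have "coeff (apery_operator A B L P) n = of_nat p ^ 2 * (B * u (p - 1))"
      unfolding coeff_apery_operator c using p_pos by simp
    then show ?thesis by (intro IpI[of "B * u (p - 1)"]) (use Z in auto)
  next
    case 4
    then have "\<not> n + 1 < p" "\<not> n < p" "\<not> n - 1 < p" by auto
    then show ?thesis unfolding coeff_apery_operator c by simp
  qed
qed

text \<open>For \<open>n + 1 < p\<close> the leading coefficient \<open>(n + 1)\<^sup>2\<close> is a unit, so modulo \<open>p\<^sup>2\<close>
  a polynomial solution is determined by its constant term.\<close>

lemma apery_solution_unique:
  assumes Q: "\<And>n. coeff (apery_operator A B L Q) n \<in> Ip 2"
    and v: "apery_like A B L v" "v 0 = 1"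
    and Z: "A \<in> Zp" "B \<in> Zp" "L \<in> Zp"
    and "n < p"
  shows "pcong 2 (coeff Q n) (coeff Q 0 * v n)"
  using \<open>n < p\<close>
proof (induction n rule: less_induct)
  case (less n)
  show ?case
  proof (cases n)
    case 0
    then show ?thesis by (simp add: v)
  next
    case (Suc m)
    define D where "D = (\<lambda>i. coeff Q i - coeff Q 0 * v i)"
    have D: "D m \<in> Ip 2" "D (m - 1) \<in> Ip 2"
      using less.IH[of m] less.IH[of "m - 1"] less.prems Suc by (auto simp: pcong_def D_def)
    define N where "N = (of_nat m :: rat)"
    have NZ: "N \<in> Zp" by (simp add: N_def)
    have vm: "(N + 1)\<^sup>2 * v (m + 1) = (A * N * (N + 1) + L) * v m - B * N\<^sup>2 * v (m - 1)"
      using v(1) by (simp add: apery_like_def N_def)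
    have "(N + 1)\<^sup>2 * D (m + 1) = coeff (apery_operator A B L Q) m + (A * N * (N + 1) + L) * D m - B * N\<^sup>2 * D (m - 1)"
      unfolding coeff_apery_operator N_def[symmetric] D_def right_diff_distrib
      using vm by (simp only: mult.left_commute[of _ "coeff Q 0"]) (simp add: algebra_simps)
    also have "\<dots> \<in> Ip 2"
      using Q D Z NZ by (intro Ip_add Ip_diff Zp_mult_Ip Zp_mult Zp_add Zp_power Zp_1)
    also have "N + 1 = of_nat n" by (simp add: N_def Suc)
    finally have "of_nat (n\<^sup>2) * D n \<in> Ip 2" by (simp add: Suc)
    moreover have "\<not> p dvd n\<^sup>2"
      using less.prems Suc prime_dvd_power[OF prime_p, of n 2] nat_dvd_not_less[of n p] by auto
    ultimately have "D n \<in> Ip 2" by (rule Ip_cancel_nat)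
    then show ?thesis by (simp add: pcong_def D_def)
  qed
qed

lemma truncated_series_lessThan: "truncated_series u p t = (\<Sum>k<p. u k * t ^ k)"
proof -
  have "{0..p - 1} = {..<p}" using p_pos by auto
  then show ?thesis by (simp add: truncated_series_def)
qed

text \<open>By hypothesis \<open>w\<close> the point a is a zero of the weight. The Taylor
  polynomial of the truncation at a then solves the second equation modulo p^2, so by uniqueness it
  is its constant term, the value at a, times the truncation of v.\<close>

lemma truncated_series_shift:
  assumes u: "apery_like A B L u" "\<And>n. u n \<in> Zp"
    and v: "apery_like A' B' L' v" "v 0 = 1"
    and Z: "B \<in> Zp" "A' \<in> Zp" "B' \<in> Zp" "L' \<in> Zp" "a \<in> Zp" "b \<in> Zp" "s \<in> Zp"
    and \<kappa>: "\<kappa> * \<kappa> = 1" and b: "b \<noteq> 0"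
    and w: "pcompose [:0, 1, - A, B:] [:a, b:] = smult (\<kappa> * b\<^sup>2) [:0, 1, - A', B':]"
    and l: "pcompose [:- L, B:] [:a, b:] = smult \<kappa> [:- L', B':]"
  shows "pcong 2 (truncated_series u p (a + b * s)) (truncated_series u p a * truncated_series v p s)"
proof -
  define P where "P = (\<Sum>k<p. monom (u k) k)"
  define Q where "Q = pcompose P [:a, b:]"
  have P: "poly P t = truncated_series u p t" for t
    unfolding P_def truncated_series_lessThan by (simp add: poly_sum poly_monom)
  have cq: "coeff [:a, b:] i \<in> Zp" for i
    using Z by (auto simp: coeff_pCons split: nat.split)
  have "coeff (pcompose (apery_operator A B L P) [:a, b:]) n \<in> Ip 2" for n
    unfolding P_def using u Z cq by (intro coeff_pcompose_Ip apery_operator_truncation)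
  then have *: "\<kappa> * coeff (apery_operator A' B' L' Q) n \<in> Ip 2" for n
    unfolding apery_operator_pcompose[OF b w l] Q_def[symmetric] by simp
  have "\<kappa> \<in> Zp" using \<kappa> square_eq_1_iff[of \<kappa>] by (auto intro: Zp_uminus)
  have Q: "coeff (apery_operator A' B' L' Q) n \<in> Ip 2" for n
    using Zp_mult_Ip[OF \<open>\<kappa> \<in> Zp\<close> *[of n]] \<kappa> by (simp flip: mult.assoc)
  \<comment> \<open>The degree stays below p, the range in which uniqueness controls the
    coefficients.\<close>
  have "degree P \<le> p - 1"
    unfolding P_def by (intro degree_sum_le) (auto intro: order.trans[OF degree_monom_le])
  then have "degree Q \<le> p - 1"
    unfolding Q_def using b by (simp add: degree_pcompose)
  then have "poly Q s = (\<Sum>n<p. coeff Q n * s ^ n)"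
    unfolding poly_altdef using p_pos
    by (intro sum.mono_neutral_left) (auto simp: coeff_eq_0)
  also have "pcong 2 \<dots> (\<Sum>n<p. coeff Q 0 * v n * s ^ n)"
  proof (rule pcong_sum)
    fix n assume "n \<in> {..<p}"
    then have "pcong 2 (s ^ n * coeff Q n) (s ^ n * (coeff Q 0 * v n))"
      using Z v by (intro pcong_mult_left apery_solution_unique[OF Q]) auto
    then show "pcong 2 (coeff Q n * s ^ n) (coeff Q 0 * v n * s ^ n)" by (simp only: mult.commute)
  qed
  also have "\<dots> = coeff Q 0 * truncated_series v p s"
    by (simp add: truncated_series_lessThan sum_distrib_left mult.assoc)
  also have "coeff Q 0 = truncated_series u p a"
    unfolding P[symmetric] by (simp add: Q_def poly_0_coeff_0[symmetric] poly_pcompose)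
  also have "poly Q s = truncated_series u p (a + b * s)"
    unfolding P[symmetric] by (simp add: Q_def poly_pcompose mult.commute)
  finally show ?thesis .
qed

lemma seq_Zp: "seq_c n \<in> Zp" "seq_d n \<in> Zp" "seq_e n \<in> Zp"
  unfolding seq_c_def seq_d_def seq_e_def by (intro Zp_sum Zp_mult Zp_power Zp_of_nat Zp_numeral minus_one_power_Zp)+

lemma truncated_series_zero: "truncated_series u p 0 = u 0"
proof -
  have "{0..p - 1} = insert 0 {1..p - 1}" by auto
  then show ?thesis by (simp add: truncated_series_def power_0_left)
qed

text \<open>At t = -1 + 9s the weight of c becomes -81 s (1 - 8s)(1 - 9s); the zeros t = 0 and t =
  1/8 correspond to s = 1/9 and s = 1/8.\<close>

lemma truncated_series_c_shift_e:
  assumes "s \<in> Zp"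
  shows "pcong 2 (truncated_series seq_c p (- 1 + 9 * s)) (truncated_series seq_c p (- 1) * truncated_series seq_e p s)"
  by (rule truncated_series_shift[OF apery_like_seq_c seq_Zp(1) apery_like_seq_e, where \<kappa> = "- 1"])
    (use assms in \<open>auto simp: seq_e_def pcompose_pCons intro: Zp_uminus\<close>)

text \<open>At t = (1 - 9s)/8 the weight of c becomes (81/64) s (1 - s)(1 - 9s); the zeros t = 0 and
  t = -1 correspond to s = 1/9 and s = 1.\<close>

lemma truncated_series_c_shift_d:
  assumes "odd p" "s \<in> Zp"
  shows "pcong 2 (truncated_series seq_c p (1/8 + - 9/8 * s)) (truncated_series seq_c p (1/8) * truncated_series seq_d p s)"
proof -
  have eighth: "x / 8 \<in> Zp" if "x \<in> Zp" for x using Zp_divide_power_2[OF assms(1) that, of 3] by simp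
  show ?thesis
    by (rule truncated_series_shift[OF apery_like_seq_c seq_Zp(1) apery_like_seq_d, where \<kappa> = 1])
      (use assms in \<open>auto simp: seq_d_def pcompose_pCons power2_eq_square intro!: eighth intro: Zp_uminus\<close>)
qed

end

section \<open>Kronecker symbols and the main theorem\<close>

lemma Legendre_eqI:
  assumes "[Legendre a (int p) = y] (mod int p)" "2 < p" "\<bar>y\<bar> \<le> 1"
  shows "Legendre a (int p) = y"
proof -
  have "\<bar>Legendre a (int p)\<bar> \<le> 1" by (simp add: Legendre_def)
  then have "\<bar>Legendre a (int p) - y\<bar> < int p" using assms(2,3) by linarith
  moreover have "int p dvd Legendre a (int p) - y" using assms(1) by (simp add: cong_iff_dvd_diff)
  ultimately show ?thesis using zdvd_not_zless[of "\<bar>Legendre a (int p) - y\<bar>" "int p"]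
    by (cases "Legendre a (int p) - y = 0") auto
qed

text \<open>Euler's criterion: 4^((p-1)/2) = 2^(p-1) is 1 modulo p by Fermat, which leaves the power
  of -1.\<close>

lemma (in prime_localization) chi_minus_4:
  assumes "odd p"
  shows "chi_minus 4 p = (- 1) ^ ((p - 1) div 2)"
proof -
  have p2: "2 < p" using assms prime_ge_2_nat[OF prime_p] by (cases "p = 2") auto
  have "coprime 2 p" using assms by simp
  then have "[2 ^ (p - 1) = 1] (mod p)"
    using fermat_theorem[OF prime_p, of 2] assms p2 by (simp add: nat_dvd_not_less)
  then have f: "[2 ^ (p - 1) = 1] (mod int p)"
    using cong_int_iff[of "2 ^ (p - 1)" 1 p] by simp
  have "(2 :: int) ^ (2 * ((p - 1) div 2)) = 4 ^ ((p - 1) div 2)" by (simp add: power_mult)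
  moreover have "2 * ((p - 1) div 2) = p - 1" using odd_half[OF assms] by simp
  ultimately have "(4 :: int) ^ ((p - 1) div 2) = 2 ^ (p - 1)" by (simp only:)
  then have "(- 4 :: int) ^ ((p - 1) div 2) = (- 1) ^ ((p - 1) div 2) * 2 ^ (p - 1)"
    by (subst power_minus) simp
  moreover have "[(- 1) ^ ((p - 1) div 2) * 2 ^ (p - 1) = (- 1) ^ ((p - 1) div 2) * 1] (mod int p)"
    by (rule cong_mult[OF cong_refl f])
  ultimately have "[Legendre (- 4) (int p) = (- 1) ^ ((p - 1) div 2)] (mod int p)"
    using euler_criterion[OF prime_p p2, of "- 4"] by (metis cong_trans mult_1_right)
  then have "Legendre (- 4) (int p) = (- 1) ^ ((p - 1) div 2)"
    by (rule Legendre_eqI) (use p2 in \<open>auto simp: power_abs\<close>)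
  then show ?thesis using p2 by (simp add: chi_minus_def kronecker_prime_def)
qed

text \<open>The sign (-1)^h from reciprocity between 3 and p cancels the one from the factor -1,
  leaving the residue of p modulo 3.\<close>

lemma (in prime_localization) chi_minus_3:
  assumes "odd p" "p \<noteq> 3"
  shows "chi_minus 3 p = chi3 (int p)"
proof -
  have p2: "2 < p" using assms prime_ge_2_nat[OF prime_p] by (cases "p = 2") auto
  define h where "h = (p - 1) div 2"
  have p3: "int p mod 3 \<noteq> 0"
  proof
    assume "int p mod 3 = 0"
    then have "3 dvd p" by presburger
    then show False using primes_dvd_imp_eq[of 3 p] prime_p assms by auto
  qed
  have "Legendre (int p) (int 3) = (if int p mod 3 = 1 then 1 else - 1)"
  proof (rule Legendre_eqI)
    have "[Legendre (int p) (int 3) = int p] (mod int 3)"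
      using euler_criterion[of 3 "int p"] by simp
    also have "[int p = (if int p mod 3 = 1 then 1 else - 1)] (mod int 3)"
    proof (cases "int p mod 3 = 1")
      case False
      then have "int p mod 3 = 2" using p3 by presburger
      then show ?thesis using False by (simp add: cong_def)
    qed (simp add: cong_def)
    finally show "[Legendre (int p) (int 3) = (if int p mod 3 = 1 then 1 else - 1)] (mod int 3)" .
  qed auto
  then have L3: "Legendre (int p) 3 = (if int p mod 3 = 1 then 1 else - 1)" by simp
  have "Legendre (int p) (int 3) * Legendre (int 3) (int p) = (- 1) ^ (h * ((3 - 1) div 2))"
    unfolding h_def by (rule Quadratic_Reciprocity) (use prime_p p2 assms in auto)
  then have qr: "Legendre (int p) 3 * Legendre 3 (int p) = (- 1) ^ h" by simp
  have "[(- 3) ^ h = (- 1) ^ h * Legendre 3 (int p)] (mod int p)"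
    using cong_mult[OF cong_refl[of "(- 1) ^ h"] cong_sym[OF euler_criterion[OF prime_p p2, of 3]]]
    by (subst power_minus) (simp add: h_def)
  then have "[Legendre (- 3) (int p) = (- 1) ^ h * Legendre 3 (int p)] (mod int p)"
    using euler_criterion[OF prime_p p2, of "- 3"] unfolding h_def by (rule cong_trans[rotated])
  also have "(- 1) ^ h * Legendre 3 (int p) = Legendre (int p) 3"
  proof -
    have "Legendre 3 (int p) = (- 1) ^ h * Legendre (int p) 3"
      using qr L3 by (auto split: if_splits)
    then show ?thesis by (simp flip: mult.assoc power_add)
  qed
  finally have "Legendre (- 3) (int p) = Legendre (int p) 3"
    by (rule Legendre_eqI) (use p2 L3 in auto)
  then show ?thesis
    using p2 p3 L3 by (simp add: chi_minus_def kronecker_prime_def chi3_def)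
qed

text \<open>Case b has N = 3 and so includes p = 2, outside the argument for odd primes. The
  truncation is 1 + 6/27 = 11/9, and 11/9 + 1 = 4 (5/9).\<close>

lemma seq_b_two: "cong_prime_power 2 2 (truncated_series seq_b 2 (1/27)) (chi_minus 3 2)"
proof -
  interpret prime_localization 2 by unfold_locales simp
  have "truncated_series seq_b 2 (1/27) = 11/9"
    by (simp add: truncated_series_def seq_b_def fact_numeral)
  moreover have "chi_minus 3 2 = - 1" by (simp add: chi_minus_def kronecker_prime_def)
  moreover have "pcong 2 (11/9) (- 1)"
  proof -
    have "5/9 \<in> Zp" by (rule ZpI[of 9 _ 5]) auto
    then have "11/9 - (- 1) \<in> Ip 2" by (rule IpI) simp
    then show ?thesis unfolding pcong_def .
  qed
  then have "cong_prime_power 2 2 (11/9) (- 1)" by (rule cong_prime_powerI) (auto intro: Zp_uminus)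
  ultimately show ?thesis by (simp only:)
qed

section \<open>Remaining values in cases c, d and e\<close>

context prime_localization
begin

lemma chi3_square:
  assumes "odd p" "p \<noteq> 3"
  shows "chi3 (int p) * chi3 (int p) = 1"
proof -
  have "\<not> 3 dvd p" using primes_dvd_imp_eq[of 3 p] prime_p assms by auto
  then have "int p mod 3 \<noteq> 0" by presburger
  then show ?thesis by (simp add: chi3_def)
qed

lemma truncated_series_cde:
  assumes "odd p" "p \<noteq> 3"
  shows "pcong 2 (truncated_series seq_c p (1/8)) (chi3 (int p))"
    and "pcong 2 (truncated_series seq_d p (1/9)) (chi3 (int p))"
    and "pcong 2 (truncated_series seq_e p (1/9)) (chi3 (int p))"
    and "pcong 2 (truncated_series seq_e p (1/8)) 1"
proof -
  define F where "F = truncated_series seq_c p"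
  define G where "G = truncated_series seq_d p"
  define H where "H = truncated_series seq_e p"
  define e where "e = chi3 (int p)"
  have e: "e * e = 1" "e \<in> Zp" unfolding e_def by (rule chi3_square[OF assms]) simp
  have eighth: "1/8 \<in> Zp" using Zp_divide_power_2[OF assms(1) Zp_1, of 3] by simp
  have "\<not> p dvd 9"
    using prime_dvd_power[OF prime_p, of 3 2] primes_dvd_imp_eq[OF prime_p, of 3] assms by auto
  then have ninth: "1/9 \<in> Zp" using Zp_divide_nat[OF Zp_1, of 9] by simp
  have FZ: "F t \<in> Zp" if "t \<in> Zp" for t
    unfolding F_def truncated_series_def using that seq_Zp by (intro Zp_sum Zp_mult Zp_power)
  have GZ: "G t \<in> Zp" if "t \<in> Zp" for t
    unfolding G_def truncated_series_def using that seq_Zp by (intro Zp_sum Zp_mult Zp_power)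
  have HZ: "H t \<in> Zp" if "t \<in> Zp" for t
    unfolding H_def truncated_series_def using that seq_Zp by (intro Zp_sum Zp_mult Zp_power)
  have F0: "F 0 = 1" by (simp add: F_def truncated_series_zero seq_c_def)
  have Fm: "pcong 2 (F (- 1)) e" unfolding F_def e_def by (rule truncated_series_c_minus_one[OF assms(1)])
  have G1: "pcong 2 (G 1) 1" unfolding G_def by (rule truncated_series_d_one[OF assms(1)])
  \<comment> \<open>The shift to e at s = 1/9, where t = 0 and F 0 = 1, and at s = 1/8, where t =
    1/8.\<close>
  have H9: "pcong 2 1 (F (- 1) * H (1/9))" and H8: "pcong 2 (F (1/8)) (F (- 1) * H (1/8))"
    using truncated_series_c_shift_e[OF ninth] truncated_series_c_shift_e[OF eighth] F0
    unfolding F_def H_def by simp_all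
  \<comment> \<open>The shift to d at s = 1/9, where t = 0, and at s = 1, where t = -1.\<close>
  have G9: "pcong 2 1 (F (1/8) * G (1/9))" and G1': "pcong 2 (F (- 1)) (F (1/8) * G 1)"
    using truncated_series_c_shift_d[OF assms(1) ninth] truncated_series_c_shift_d[OF assms(1) Zp_1] F0
    unfolding F_def G_def by simp_all
  \<comment> \<open>Since e is its own inverse, dividing by a factor congruent to e amounts to
    multiplying by e.\<close>
  have unit: "pcong 2 y (e * z)" if "pcong 2 z (x * y)" "pcong 2 x e" "y \<in> Zp" for x y z
  proof -
    have "x * y - e * y \<in> Ip 2" using Ip_mult_Zp[of "x - e" 2 y] that by (simp add: pcong_def algebra_simps)
    with that(1) have "pcong 2 z (e * y)" unfolding pcong_def using Ip_add[of "z - x * y" 2 "x * y - e * y"] by simp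
    from pcong_mult_left[OF e(2) pcong_sym[OF this]] show ?thesis using e(1) by (simp flip: mult.assoc)
  qed
  have "pcong 2 (F (1/8)) (F (1/8) * G 1)"
    using pcong_mult_left[OF FZ[OF eighth] pcong_sym[OF G1]] by simp
  also have "pcong 2 \<dots> (F (- 1))" by (rule pcong_sym[OF G1'])
  also note Fm
  finally have F8: "pcong 2 (F (1/8)) e" .
  then show "pcong 2 (truncated_series seq_c p (1/8)) (chi3 (int p))" unfolding F_def e_def .
  show "pcong 2 (truncated_series seq_d p (1/9)) (chi3 (int p))"
    using unit[OF G9 F8 GZ[OF ninth]] unfolding G_def e_def by simp
  show "pcong 2 (truncated_series seq_e p (1/9)) (chi3 (int p))"
    using unit[OF H9 Fm HZ[OF ninth]] unfolding H_def e_def by simp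
  have "pcong 2 (H (1/8)) (e * F (1/8))" by (rule unit[OF H8 Fm HZ[OF eighth]])
  also have "pcong 2 \<dots> (e * e)" by (rule pcong_mult_left[OF e(2) F8])
  finally show "pcong 2 (truncated_series seq_e p (1/8)) 1" unfolding e(1) H_def .
qed

end

theorem mainTheorem2:
  fixes p :: nat
  assumes "prime p"
  shows "(\<not> p dvd 4 \<longrightarrow>
           cong_prime_power p 2 (truncated_series seq_a p (1/16)) (chi_minus 4 p))
       \<and> (\<not> p dvd 3 \<longrightarrow>
           cong_prime_power p 2 (truncated_series seq_b p (1/27)) (chi_minus 3 p))
       \<and> (\<not> p dvd 6 \<longrightarrow>
           cong_prime_power p 2 (truncated_series seq_c p (1/8)) (chi_minus 3 p) \<and>
           cong_prime_power p 2 (truncated_series seq_c p (-1)) (chi_minus 3 p))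
       \<and> (\<not> p dvd 6 \<longrightarrow>
           cong_prime_power p 2 (truncated_series seq_d p (1/9)) (chi_minus 3 p) \<and>
           cong_prime_power p 2 (truncated_series seq_d p 1) 1)
       \<and> (\<not> p dvd 6 \<longrightarrow>
           cong_prime_power p 2 (truncated_series seq_e p (1/9)) (chi_minus 3 p) \<and>
           cong_prime_power p 2 (truncated_series seq_e p (1/8)) 1)
       \<and> (\<not> p dvd 8 \<longrightarrow>
           cong_prime_power p 2 (truncated_series seq_f p (1/8)) (chi_minus 4 p) \<and>
           cong_prime_power p 2 (truncated_series seq_f p (1/4)) 1)"
proof -
  interpret prime_localization p by unfold_locales (rule assms)
  have odd: "odd p" if "p \<noteq> 2"
    using that assms prime_odd_nat[of p] prime_ge_2_nat[of p] by auto
  have dvds: "p \<noteq> 2" if "\<not> p dvd 4 \<or> \<not> p dvd 6 \<or> \<not> p dvd 8" using that by auto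
  have dvd3: "p \<noteq> 3" if "\<not> p dvd 3 \<or> \<not> p dvd 6" using that by auto
  have chi4: "odd p \<Longrightarrow> pcong 2 x ((- 1) ^ ((p - 1) div 2)) \<Longrightarrow> cong_prime_power p 2 x (chi_minus 4 p)" for x
    by (simp add: chi_minus_4 cong_prime_powerI)
  have chi3: "odd p \<Longrightarrow> p \<noteq> 3 \<Longrightarrow> pcong 2 x (chi3 (int p)) \<Longrightarrow> cong_prime_power p 2 x (chi_minus 3 p)" for x
    by (simp add: chi_minus_3 cong_prime_powerI)
  have one: "pcong 2 x 1 \<Longrightarrow> cong_prime_power p 2 x 1" for x
    by (simp add: cong_prime_powerI)
  have b: "cong_prime_power p 2 (truncated_series seq_b p (1/27)) (chi_minus 3 p)" if "p \<noteq> 3"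
  proof (cases "p = 2")
    case False
    have "\<not> 3 dvd p" using primes_dvd_imp_eq[of 3 p] assms that by auto
    then have m: "p mod 3 \<noteq> 0" by presburger
    then have "(if p mod 3 = 1 then 1 else - 1) = chi3 (int p)"
      by (auto simp: chi3_def zmod_int[of p 3, simplified, symmetric])
    with truncated_series_b[OF odd[OF False] m] chi3[OF odd[OF False] that] show ?thesis by simp
  qed (use seq_b_two in simp)
  have a: "cong_prime_power p 2 (truncated_series seq_a p (1/16)) (chi_minus 4 p)" if "p \<noteq> 2"
    using odd[OF that] by (intro chi4 truncated_series_a)
  have cde: "cong_prime_power p 2 (truncated_series seq_c p (1/8)) (chi_minus 3 p)"
    "cong_prime_power p 2 (truncated_series seq_c p (- 1)) (chi_minus 3 p)"
    "cong_prime_power p 2 (truncated_series seq_d p (1/9)) (chi_minus 3 p)"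
    "cong_prime_power p 2 (truncated_series seq_d p 1) 1"
    "cong_prime_power p 2 (truncated_series seq_e p (1/9)) (chi_minus 3 p)"
    "cong_prime_power p 2 (truncated_series seq_e p (1/8)) 1" if "p \<noteq> 2" "p \<noteq> 3"
    using odd[OF that(1)] that(2)
    by (simp_all add: chi3 one truncated_series_cde truncated_series_c_minus_one truncated_series_d_one)
  have f: "cong_prime_power p 2 (truncated_series seq_f p (1/8)) (chi_minus 4 p)"
    "cong_prime_power p 2 (truncated_series seq_f p (1/4)) 1" if "p \<noteq> 2"
    using chi4[OF odd truncated_series_f_eighth[OF odd]] one[OF truncated_series_f_quarter[OF odd]] that
    by simp_all
  show ?thesis
    using a b cde f dvds dvd3 by simp
qed

end
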